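(* Let $\phi(z)=\sum_{n\ge 1,\ n\text{ odd}}a(n)q_z^n$ be the meromorphic modular form $$\phi(z)=(\eta(2z)\eta(4z))^4\,\frac{1-96\psi(2z)+256\psi(2z)^2}{(1+16\psi(2z))^2},\qquad \psi(z)=\frac{\eta(z)^8\eta(4z)^{16}}{\eta(2z)^{24}},$$ whose Fourier coefficients $a(n)$ at $i\infty$ are integers. Then $n\mid a(n)$ for all $n\in\mathbb{N}$.
   Context: Here $z$ lies in the upper half plane, $q_z=e^{2\pi i z}$, $\mathbb{N}=\{1,2,3,\dots\}$, and $\eta(z)=q_z^{1/24}\prod_{n\ge1}(1-q_z^n)$ is the Dedekind eta function. The function $\phi$ is a meromorphic modular form of weight 4 on $\Gamma_0(8)$ with expansion $\phi(z)=q_z-132q_z^3+5630q_z^5-189672q_z^7+\cdots$ near $i\infty$ (only odd powers occur; $a(n)=0$ for even $n$). *)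

theory Defs
  imports "HOL-Complex_Analysis.Complex_Analysis"
begin

definition qexp :: "complex \<Rightarrow> complex" where
  "qexp z = exp (2 * of_real pi * \<i> * z)"

(* The factor q_z^(1/24) is exp (2 pi i z / 24), not a principal-branch power of q_z. *)
definition dedekind_eta :: "complex \<Rightarrow> complex" where
  "dedekind_eta z = qexp (z / 24) * (\<Prod>n. 1 - qexp z ^ Suc n)"

definition psi :: "complex \<Rightarrow> complex" where
  "psi z = dedekind_eta z ^ 8 * dedekind_eta (4 * z) ^ 16 / dedekind_eta (2 * z) ^ 24"

definition phi :: "complex \<Rightarrow> complex" where
  "phi z = (dedekind_eta (2 * z) * dedekind_eta (4 * z)) ^ 4 *
     ((1 - 96 * psi (2 * z) + 256 * psi (2 * z) ^ 2) / (1 + 16 * psi (2 * z)) ^ 2)"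

(* The expansion is only required near i*infinity, since phi has poles in the upper
   half plane.  By uniqueness of power series, f determines the coefficients a. *)
definition has_fourier_expansion_at_ii_inf ::
  "(complex \<Rightarrow> complex) \<Rightarrow> (nat \<Rightarrow> complex) \<Rightarrow> bool" where
  "has_fourier_expansion_at_ii_inf f a \<longleftrightarrow>
     (\<exists>Y>0. \<forall>z. Im z > Y \<longrightarrow> (\<lambda>n. a n * qexp z ^ n) sums f z)"

end

theory Submission
  imports Defs
begin

text \<open>
  With nome \<open>q\<^sup>2\<close> put \<open>a = \<theta>\<^sub>3\<^sup>2\<close>, \<open>c = \<theta>\<^sub>2\<^sup>2\<close>, \<open>E = a\<^sup>2 + c\<^sup>2\<close> and
  \<open>w = a c (a\<^sup>2 - c\<^sup>2) / (4 E\<^sup>2) = q + \<dots>\<close>, a power series with integer coefficients. Writing \<open>D = q d/dq\<close>,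
  the form \<open>\<phi>\<close> equals \<open>E D w\<close>, while Ramanujan's series in signature 4 says
  \<open>E = \<Sum>\<^sub>m (4 m)! / (m!)\<^sup>4 w^(2 m)\<close>. Hence \<open>\<phi> = D \<Phi>\<close> where \<open>\<Phi>\<close> is a series in odd powers of \<open>w\<close> with
  coefficients \<open>(4 m)! / ((m!)\<^sup>4 (2 m + 1))\<close>. These are integers because \<open>2 m + 1\<close> divides
  the central binomial coefficient \<open>4 m choose 2 m\<close>, and \<open>n\<close> divides the \<open>n\<close>-th coefficient of \<open>D \<Phi>\<close>.

  The differential equations behind Ramanujan's series come from the doubling equations
  \<open>a(q) = a(q\<^sup>2) + c(q\<^sup>2)\<close> and \<open>c(q)\<^sup>2 = 4 a(q\<^sup>2) c(q\<^sup>2)\<close> alone: the defect of each equation is multiplied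
  by a known factor under \<open>q \<mapsto> q\<^sup>2\<close>, and comparing orders of vanishing at \<open>0\<close> forces it to be zero.
  The doubling equations in turn follow from the Jacobi triple product.
\<close>

unbundle no vec_syntax

section \<open>The derivation q d/dq on power series\<close>

definition qD :: "'a::comm_ring_1 fps \<Rightarrow> 'a fps" where
  "qD F = fps_X * fps_deriv F"

lemma qD_nth [simp]: "qD F $ n = of_nat n * F $ n"
  by (cases n) (simp_all add: qD_def)

lemma qD_add [simp]: "qD (F + G) = qD F + qD G"
  and qD_diff [simp]: "qD (F - G) = qD F - qD G"
  and qD_mult [simp]: "qD (F * G) = qD F * G + F * qD G"
  and qD_numeral [simp]: "qD (numeral k) = 0"
  and qD_one [simp]: "qD 1 = 0"
  by (simp_all add: qD_def algebra_simps)

lemma qD_power [simp]: "qD (F ^ n) = of_nat n * F ^ (n - 1) * qD F"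
  by (simp add: qD_def fps_deriv_power' algebra_simps)

lemma qD_inverse:
  fixes F :: "'a::field fps"
  assumes "F $ 0 \<noteq> 0"
  shows "qD (inverse F) = - qD F * inverse F ^ 2"
proof -
  have "F * inverse F = 1"
    using assms by (simp add: inverse_mult_eq_1')
  then have "qD (F * inverse F) = 0"
    by simp
  then have "qD F * inverse F + F * qD (inverse F) = 0"
    by simp
  then have "inverse F * (F * qD (inverse F)) = - qD F * inverse F ^ 2"
    by algebra
  then show ?thesis
    using \<open>F * inverse F = 1\<close> by algebra
qed

text \<open>The chain rule for X d/dX. The extra factor \<open>G\<close> on the left absorbs the
  factor X hidden in \<open>qD F\<close>, which becomes \<open>G\<close> under composition, so no
  division by \<open>G\<close> occurs.\<close>

lemma qD_compose:
  fixes F G :: "'a::idom fps"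
  assumes "G $ 0 = 0"
  shows "G * qD (F oo G) = (qD F oo G) * qD G"
  using assms by (simp add: qD_def fps_compose_deriv fps_compose_mult_distrib)

lemma qD_compose_X2:
  fixes F :: "'a::idom fps"
  shows "qD (F oo fps_X ^ 2) = 2 * (qD F oo fps_X ^ 2)"
proof -
  have "fps_X ^ 2 * qD (F oo fps_X ^ 2) = fps_X ^ 2 * (2 * (qD F oo fps_X ^ 2))"
    using qD_compose [of "fps_X ^ 2" F] by (simp add: qD_def power2_eq_square algebra_simps)
  then show ?thesis
    by simp
qed

lemma fps_compose_X2_eq_0_iff [simp]:
  fixes F :: "'a::idom fps"
  shows "F oo fps_X ^ 2 = 0 \<longleftrightarrow> F = 0"
  by (subst fps_compose_eq_0_iff) auto

lemma subdegree_compose_X2: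
  fixes F :: "'a::idom fps"
  shows "subdegree (F oo fps_X ^ 2) = 2 * subdegree F"
  by (subst subdegree_fps_compose) auto

section \<open>Hypergeometric coefficients and integrality\<close>

text \<open>The hypergeometric series 3F2(1/4, 1/2, 3/4; 1, 1; 256 X^2): the coefficient of X^(2 m)
  is (4 m)! / (m!)^4.\<close>

definition central_fps :: "'a::field_char_0 fps" where
  "central_fps = Abs_fps (\<lambda>n. if even n then of_nat (fact (2 * n)) / of_nat (fact (n div 2)) ^ 4 else 0)"

text \<open>Consecutive coefficients \<open>A m\<close> of X^(2 m) satisfy a first-order recurrence,
  and \<open>qD\<close> multiplies X^n by n. The cubic on the right is (n + 1)(2 n + 1)(2 n + 3),
  and (2 m + 2)^3 = 8 (m + 1)^3.\<close>

lemma central_fps_ode: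
  "qD (qD (qD (central_fps :: 'a::field_char_0 fps))) = 64 * fps_X ^ 2 *
     (4 * qD (qD (qD central_fps)) + 12 * qD (qD central_fps) + 11 * qD central_fps + 3 * central_fps)"
proof (rule fps_ext)
  fix n
  define A :: "nat \<Rightarrow> 'a" where "A m = fact (4 * m) / fact m ^ 4" for m
  have A: "(of_nat m + 1) ^ 3 * A (Suc m) = 4 * (4 * of_nat m + 1) * (4 * of_nat m + 2) * (4 * of_nat m + 3) * A m" for m
  proof -
    have "4 * Suc m = Suc (Suc (Suc (Suc (4 * m))))" by simp
    then have "A (Suc m) = (of_nat (Suc (Suc (Suc (Suc (4 * m))))) * of_nat (Suc (Suc (Suc (4 * m)))) *
        of_nat (Suc (Suc (4 * m))) * of_nat (Suc (4 * m)) * fact (4 * m)) / (of_nat (Suc m) * fact m) ^ 4"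
      unfolding A_def by (simp only: fact_Suc of_nat_mult mult.assoc) 
    moreover have "(1 + of_nat m :: 'a) \<noteq> 0"
      using of_nat_neq_0 [of m, where ?'a = 'a] by simp
    ultimately show ?thesis
      by (simp add: A_def divide_simps) (simp add: algebra_simps power2_eq_square power3_eq_cube power4_eq_xxxx)
  qed
  have coeff: "(central_fps :: 'a fps) $ k = (if even k then A (k div 2) else 0)" for k
    by (auto simp: central_fps_def A_def elim!: evenE)
  show "qD (qD (qD (central_fps :: 'a fps))) $ n = (64 * fps_X ^ 2 *
     (4 * qD (qD (qD central_fps)) + 12 * qD (qD central_fps) + 11 * qD central_fps + 3 * central_fps)) $ n"
  proof (cases "n < 2")
    case True
    then show ?thesis
      by (cases n) (auto simp: mult.assoc numeral_fps_const fps_X_power_mult_nth coeff)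
  next
    case False
    then obtain k where n: "n = Suc (Suc k)"
      by (metis add_2_eq_Suc le_Suc_ex linorder_not_less)
    show ?thesis
    proof (cases "even k")
      case True
      then obtain m where k: "k = 2 * m" by blast
      have "A (Suc m) * (of_nat (Suc (Suc (2 * m)))) ^ 3 = 8 * ((of_nat m + 1) ^ 3 * A (Suc m))"
        by (simp add: algebra_simps power3_eq_cube)
      also have "\<dots> = 64 * (32 * of_nat m ^ 3 + 48 * of_nat m ^ 2 + 22 * of_nat m + 3) * A m"
        unfolding A by (simp add: algebra_simps power3_eq_cube power2_eq_square)
      finally show ?thesis
        by (simp add: n k mult.assoc numeral_fps_const fps_X_power_mult_nth coeff)
          (simp add: algebra_simps power3_eq_cube power2_eq_square)
    next
      case False
      then show ?thesis
        by (simp add: n mult.assoc numeral_fps_const fps_X_power_mult_nth coeff)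
    qed
  qed
qed

text \<open>The coefficient of \<open>X\<^sup>0\<close> is \<open>0\<close> because of \<open>x / 0 = 0\<close>; that of \<open>X^(2 m + 1)\<close>
is the Catalan number with index \<open>2 m\<close> times \<open>(2 m choose m)\<^sup>2\<close>.\<close>

definition catalan_fps :: "'a::field_char_0 fps" where
  "catalan_fps = Abs_fps (\<lambda>n. central_fps $ (n - 1) / of_nat n)"

lemma qD_catalan_fps: "qD catalan_fps = (fps_X * central_fps :: 'a::field_char_0 fps)"
proof (rule fps_ext)
  fix n show "qD catalan_fps $ n = (fps_X * central_fps :: 'a fps) $ n"
    by (cases n) (simp_all add: catalan_fps_def del: of_nat_Suc)
qed

text \<open>Integrality of the Catalan numbers: \<open>Suc n\<close> divides
  \<open>n * (2 * n choose n)\<close> by absorption and is coprime to \<open>n\<close>.\<close>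

lemma Suc_dvd_central_binomial: "Suc n dvd (2 * n choose n)"
proof -
  have "Suc n * (2 * n choose Suc n) = n * (2 * n choose n)"
    by (metis add_diff_cancel_left' binomial_absorb_comp binomial_absorption mult.commute mult_2_right)
  then have "Suc n dvd n * (2 * n choose n)"
    by (metis dvd_triv_left)
  moreover have "coprime (Suc n) n"
    by simp
  ultimately show ?thesis
    by (simp add: coprime_dvd_mult_right_iff)
qed

text \<open>Isolates the binomial coefficient from which the denominator 2 m + 1 will be
  cancelled.\<close>

lemma fact_4_times: "fact (4 * m) = (4 * m choose (2 * m)) * (2 * m choose m) ^ 2 * fact m ^ 4"
  for m :: nat
proof -
  have 1: "fact (2 * m) = fact m * fact m * (2 * m choose m)"
    using binomial_fact_lemma [of m "2 * m"] by (simp add: mult_2)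
  have "fact (4 * m) = fact (2 * m) * fact (2 * m) * (4 * m choose (2 * m))"
    using binomial_fact_lemma [of "2 * m" "4 * m"] by simp
  then show ?thesis
    unfolding 1 by (simp add: power2_eq_square power4_eq_xxxx mult_ac)
qed

section \<open>Power series with integer coefficients\<close>

definition int_fps :: "'a::ring_1 fps \<Rightarrow> bool" where
  "int_fps F \<longleftrightarrow> (\<forall>n. F $ n \<in> \<int>)"

lemma int_fps_add: "int_fps F \<Longrightarrow> int_fps G \<Longrightarrow> int_fps (F + G)"
  and int_fps_diff: "int_fps F \<Longrightarrow> int_fps G \<Longrightarrow> int_fps (F - G)"
  and int_fps_mult: "int_fps F \<Longrightarrow> int_fps G \<Longrightarrow> int_fps (F * G)"
  and int_fps_one: "int_fps 1"
  and int_fps_X: "int_fps fps_X"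
  and int_fps_numeral: "int_fps (numeral k)"
  by (auto simp: int_fps_def fps_mult_nth fps_X_def fps_numeral_nth)

lemma int_fps_power: "int_fps F \<Longrightarrow> int_fps (F ^ n)"
  by (induction n) (auto intro: int_fps_mult int_fps_one)

lemma int_fps_compose: "int_fps F \<Longrightarrow> int_fps G \<Longrightarrow> int_fps (F oo G)"
  using int_fps_power [of G] by (auto simp: int_fps_def fps_compose_nth)

lemma int_fps_inverse:
  fixes F :: "'a::field fps"
  assumes "int_fps F" "F $ 0 = 1"
  shows "int_fps (inverse F)"
proof -
  have "inverse F $ n \<in> \<int>" for n
  proof (induction n rule: less_induct)
    case (less n)
    show ?case
    proof (cases "n = 0")
      case True
      then show ?thesis by (simp add: assms)
    next
      case False
      then have "inverse F $ n = - (\<Sum>i=1..n. F $ i * inverse F $ (n - i))"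
        by (cases n) (simp_all add: fps_inverse_def assms)
      then show ?thesis
        using assms less by (auto simp: int_fps_def)
    qed
  qed
  then show ?thesis
    by (simp add: int_fps_def)
qed

lemmas int_fps_intros = int_fps_add int_fps_diff int_fps_mult int_fps_one int_fps_X
  int_fps_numeral int_fps_power int_fps_compose int_fps_inverse

lemma int_catalan_fps: "int_fps (catalan_fps :: 'a::field_char_0 fps)"
proof -
  have "(catalan_fps :: 'a fps) $ n \<in> \<int>" for n
  proof (cases "odd n")
    case True
    then obtain m where n: "n = 2 * m + 1" by (metis oddE)
    obtain k where k: "(4 * m choose (2 * m)) = (2 * m + 1) * k"
      using Suc_dvd_central_binomial [of "2 * m"] by (auto elim: dvdE)
    have "(catalan_fps :: 'a fps) $ n = of_nat (fact (4 * m)) / (of_nat (2 * m + 1) * of_nat (fact m) ^ 4)"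
      by (simp add: catalan_fps_def central_fps_def n mult.commute)
    also have "\<dots> = of_nat (k * (2 * m choose m) ^ 2)"
    proof -
      have *: "s * k * b * F / (s * F) = k * b" if "s \<noteq> 0" "F \<noteq> 0" for s k b F :: 'a
        using that by (simp add: field_simps)
      have "(of_nat (2 * m + 1) :: 'a) \<noteq> 0"
        unfolding of_nat_eq_0_iff by simp
      then show ?thesis
        unfolding fact_4_times k of_nat_mult of_nat_power by (intro *) auto
    qed
    finally show ?thesis
      by (metis Ints_of_nat)
  qed (auto simp: catalan_fps_def central_fps_def elim!: oddE)
  then show ?thesis
    by (simp add: int_fps_def)
qed

section \<open>Differential equations from the doubling equations\<close>

text \<open>The intended instance is \<open>a = \<theta>\<^sub>3(q\<^sup>2)\<^sup>2\<close>, \<open>c = \<theta>\<^sub>2(q\<^sup>2)\<^sup>2\<close> in the variable \<open>q\<close> (nome \<open>q\<^sup>2\<close>), so that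
\<open>c / a\<close> is the elliptic modulus and the two doubling equations are the Landen transformation.\<close>

locale theta_pair =
  fixes a c :: "'a::field_char_0 fps"
  assumes a_0: "a $ 0 = 1" and c_0: "c $ 0 = 0" and c_1: "c $ 1 = 4"
    and a_double: "a = (a oo fps_X ^ 2) + (c oo fps_X ^ 2)"
    and c_double: "c ^ 2 = 4 * (a oo fps_X ^ 2) * (c oo fps_X ^ 2)"
begin

text \<open>The classical formula for the logarithmic derivative of the modulus
  \<open>c / a\<close>. Its defect satisfies \<open>c * W = 4 * (a1 - c1) * W1\<close>; since
  \<open>c\<close> has order 1 and \<open>a1 - c1\<close> is a unit, a nonzero \<open>W\<close> of
  order n would give 1 + n = 2 n.\<close>

lemma qD_quotient: "a * qD c - c * qD a = a * c * (a ^ 2 - c ^ 2)"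
proof -
  define W where "W = a * qD c - c * qD a - a * c * (a ^ 2 - c ^ 2)"
  define a1 c1 A C W1 where defs: "a1 = a oo fps_X ^ 2" "c1 = c oo fps_X ^ 2"
    "A = qD a oo fps_X ^ 2" "C = qD c oo fps_X ^ 2" "W1 = W oo fps_X ^ 2"
  have W1: "W1 = a1 * C - c1 * A - a1 * c1 * (a1 ^ 2 - c1 ^ 2)"
    unfolding defs W_def
    by (simp add: fps_compose_sub_distrib fps_compose_mult_distrib fps_compose_power)
  have a: "a = a1 + c1" and c: "c ^ 2 = 4 * a1 * c1"
    using a_double c_double by (simp_all add: defs)
  have Da: "qD a = 2 * A + 2 * C"
    by (subst a_double) (simp add: qD_compose_X2 defs)
  have "qD (c ^ 2) = 4 * (2 * A * c1 + 2 * a1 * C)"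
    unfolding c_double by (simp add: qD_compose_X2 defs algebra_simps)
  then have "2 * (c * qD c) = 2 * (4 * (A * c1 + a1 * C))"
    by (simp add: algebra_simps)
  then have Dc: "c * qD c = 4 * (A * c1 + a1 * C)"
    by (subst (asm) mult_cancel_left) simp
  \<comment> \<open>Only \<open>c ^ 2\<close> and \<open>c * qD c\<close> are polynomials in the
    series at q^2, so the defect is multiplied by \<open>c\<close> first.\<close>
  have "c * W = a * (c * qD c) - c ^ 2 * qD a - a * c ^ 2 * (a ^ 2 - c ^ 2)"
    unfolding W_def by (simp add: algebra_simps power2_eq_square)
  also have "\<dots> = 4 * (a1 - c1) * W1"
    unfolding Dc Da c unfolding W1 a by algebra
  finally have eq: "c * W = 4 * (a1 - c1) * W1" .
  \<comment> \<open>The orders only force \<open>W\<close> to vanish to order exactly \<open>1\<close>; its coefficient there is \<open>4 - 4\<close>.\<close>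
  have "W = 0"
  proof (rule ccontr)
    assume nz: "W \<noteq> 0"
    have sc: "subdegree c = 1"
      using c_0 c_1 by (intro subdegreeI) auto
    then have "c \<noteq> 0" by auto
    have c10: "c1 $ 0 = 0" "a1 $ 0 = 1"
      by (simp_all add: defs c_0 a_0)
    have sf: "subdegree (4 * (a1 - c1)) = 0"
      by (simp add: c10)
    have "4 * (a1 - c1) \<noteq> 0"
      using c10 by (metis diff_zero fps_sub_nth fps_zero_nth mult_eq_0_iff zero_neq_numeral zero_neq_one)
    moreover have "W1 \<noteq> 0"
      using nz by (simp add: defs)
    ultimately have "subdegree c + subdegree W = subdegree W1"
      using eq sf \<open>c \<noteq> 0\<close> nz by (metis add_0 subdegree_mult)
    then have "subdegree W = 1"
      by (simp add: sc defs subdegree_compose_X2)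
    moreover have "W $ 1 = 0"
      by (simp add: W_def fps_mult_nth_1 a_0 c_0 c_1 power2_eq_square)
    ultimately show False
      using nz by (metis nth_subdegree_nonzero)
  qed
  then show ?thesis
    by (simp add: W_def)
qed

text \<open>Divided by \<open>a ^ 3\<close> this is the linear equation D^2 (1/a) = - c^2 (a^2 -
  c^2) / a. The defect obeys \<open>a1 ^ 2 * V = 4 * a ^ 2 * V1\<close> with units \<open>a1\<close>
  and \<open>a\<close>, so a nonzero \<open>V\<close> would have order n = 2 n, that is 0, yet its
  constant term vanishes.\<close>

lemma qD_qD_a: "2 * qD a ^ 2 - a * qD (qD a) + a ^ 2 * c ^ 2 * (a ^ 2 - c ^ 2) = 0"
proof -
  define V where "V = 2 * qD a ^ 2 - a * qD (qD a) + a ^ 2 * c ^ 2 * (a ^ 2 - c ^ 2)"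
  define a1 c1 A C A2 C2 V1 where defs: "a1 = a oo fps_X ^ 2" "c1 = c oo fps_X ^ 2"
    "A = qD a oo fps_X ^ 2" "C = qD c oo fps_X ^ 2"
    "A2 = qD (qD a) oo fps_X ^ 2" "C2 = qD (qD c) oo fps_X ^ 2" "V1 = V oo fps_X ^ 2"
  have V1: "V1 = 2 * A ^ 2 - a1 * A2 + a1 ^ 2 * c1 ^ 2 * (a1 ^ 2 - c1 ^ 2)"
    unfolding defs V_def
    by (simp add: fps_compose_sub_distrib fps_compose_add_distrib fps_compose_mult_distrib fps_compose_power)
  have a: "a = a1 + c1" and c: "c ^ 2 = 4 * a1 * c1"
    using a_double c_double by (simp_all add: defs)
  have Da: "qD a = 2 * A + 2 * C"
    by (subst a_double) (simp add: qD_compose_X2 defs)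
  have DDa: "qD (qD a) = 4 * A2 + 4 * C2"
    unfolding Da by (simp add: qD_compose_X2 defs)
  \<comment> \<open>\<open>R1\<close> and \<open>R2\<close> are \<open>qD_quotient\<close> and its
    derivative, both taken at q^2. Modulo these relations \<open>V\<close> becomes a multiple of
    \<open>V1\<close>.\<close>
  have R1: "a1 * C - c1 * A = a1 * c1 * (a1 ^ 2 - c1 ^ 2)"
    using arg_cong [OF qD_quotient, of "\<lambda>F. F oo fps_X ^ 2"]
    by (simp add: defs fps_compose_sub_distrib fps_compose_mult_distrib fps_compose_power)
  have "qD (a * qD c - c * qD a) = qD (a * c * (a ^ 2 - c ^ 2))"
    using qD_quotient by simp
  then have "a * qD (qD c) - c * qD (qD a) =
      (qD a * c + a * qD c) * (a ^ 2 - c ^ 2) + a * c * (2 * a * qD a - 2 * c * qD c)"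
    by (simp add: algebra_simps)
  from arg_cong [OF this, of "\<lambda>F. F oo fps_X ^ 2"]
  have R2: "a1 * C2 - c1 * A2 = (A * c1 + a1 * C) * (a1 ^ 2 - c1 ^ 2) + a1 * c1 * (2 * a1 * A - 2 * c1 * C)"
    by (simp add: defs fps_compose_sub_distrib fps_compose_add_distrib fps_compose_mult_distrib fps_compose_power)
  have "a1 ^ 2 * V = 4 * a ^ 2 * V1"
    unfolding V_def DDa unfolding Da c unfolding V1 a using R1 R2 by algebra
  moreover have "subdegree a1 = 0" "subdegree a = 0"
    by (simp_all add: defs a_0)
  moreover have "a1 \<noteq> 0" "a \<noteq> 0"
    using a_0 by (auto simp: defs)
  ultimately have "V \<noteq> 0 \<Longrightarrow> subdegree V = subdegree V1"
    by (metis (no_types, opaque_lifting) V1 add_0 subdegree_mult subdegree_numeral subdegree_power mult_0_right mult_eq_0_iff power_eq_0_iff zero_neq_numeral)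
  then have "V \<noteq> 0 \<Longrightarrow> subdegree V = 0"
    by (simp add: defs subdegree_compose_X2)
  moreover have "V $ 0 = 0"
    by (simp add: V_def c_0 fps_power_zeroth)
  ultimately have "V = 0"
    by (metis nth_subdegree_nonzero)
  then show ?thesis
    by (simp add: V_def)
qed


section \<open>The form E, the variable w and their first derivatives\<close>

definition E :: "'a fps" where "E = a ^ 2 + c ^ 2"

definition w :: "'a fps" where
  "w = fps_const (1 / 4) * (a * c * (a ^ 2 - c ^ 2)) * inverse E ^ 2"

text \<open>The square root of \<open>1 - 256 * w ^ 2\<close> with constant term 1, made rational in
  \<open>a\<close> and \<open>c\<close>.\<close>

definition r :: "'a fps" where
  "r = (a ^ 4 - 6 * a ^ 2 * c ^ 2 + c ^ 4) * inverse E ^ 2"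

lemma E_0: "E $ 0 = 1" and w_0: "w $ 0 = 0" and r_0: "r $ 0 = 1"
  by (simp_all add: E_def w_def r_def a_0 c_0 fps_power_zeroth)

lemma E_inverse: "E * inverse E = 1"
  by (simp add: inverse_mult_eq_1' E_0)

lemma E_w: "4 * E ^ 2 * w = a * c * (a ^ 2 - c ^ 2)"
proof -
  have "4 * E ^ 2 * w = (4 * fps_const (1 / 4)) * (E * inverse E) ^ 2 * (a * c * (a ^ 2 - c ^ 2))"
    unfolding w_def by algebra
  also have "4 * fps_const (1 / 4 :: 'a) = 1"
    by (simp add: numeral_fps_const)
  finally show ?thesis
    by (simp add: E_inverse)
qed

lemma E_r: "E ^ 2 * r = a ^ 4 - 6 * a ^ 2 * c ^ 2 + c ^ 4"
proof -
  have "E ^ 2 * r = (E * inverse E) ^ 2 * (a ^ 4 - 6 * a ^ 2 * c ^ 2 + c ^ 4)"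
    unfolding r_def by algebra
  then show ?thesis
    by (simp add: E_inverse)
qed

lemma E_nonzero: "E \<noteq> 0" and a_nonzero: "a \<noteq> 0" and r_nonzero: "r \<noteq> 0"
  using E_0 a_0 r_0 by auto

lemma w_nonzero: "w \<noteq> 0"
proof
  assume "w = 0"
  then have "(a * c * (a ^ 2 - c ^ 2)) $ 1 = 0"
    by (simp flip: E_w)
  then show False
    using c_1 by (simp add: fps_mult_nth_1 a_0 c_0 fps_power_zeroth)
qed

lemma r_square: "r ^ 2 = 1 - 256 * w ^ 2"
proof -
  have "E ^ 4 * r ^ 2 = (E ^ 2 * r) ^ 2"
    by algebra
  also have "\<dots> = E ^ 4 - 16 * (4 * E ^ 2 * w) ^ 2"
    unfolding E_r E_w unfolding E_def by algebra
  also have "\<dots> = E ^ 4 * (1 - 256 * w ^ 2)"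
    by algebra
  finally show ?thesis
    by (subst (asm) mult_cancel_left) (simp add: E_nonzero)
qed

text \<open>As \<open>w\<close> is homogeneous of degree 0 in \<open>a\<close> and \<open>c\<close>,
  its derivative is a multiple of the Wronskian \<open>a * qD c - c * qD a\<close>, which
  \<open>qD_quotient\<close> evaluates.\<close>

lemma qD_w: "qD w = w * r * E"
proof -
  have DE: "qD E = 2 * (a * qD a + c * qD c)"
    by (simp add: E_def algebra_simps)
  have "qD (4 * E ^ 2 * w) = qD (a * c * (a ^ 2 - c ^ 2))"
    by (simp add: E_w)
  then have "8 * E * qD E * w + 4 * E ^ 2 * qD w =
      (qD a * c + a * qD c) * (a ^ 2 - c ^ 2) + a * c * (2 * a * qD a - 2 * c * qD c)"
    by (simp add: algebra_simps)
  then have "4 * E ^ 3 * qD w = E * ((qD a * c + a * qD c) * (a ^ 2 - c ^ 2) + a * c * (2 * a * qD a - 2 * c * qD c))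
      - 2 * qD E * (4 * E ^ 2 * w)"
    by algebra
  also have "\<dots> = (a * qD c - c * qD a) * (a ^ 4 - 6 * a ^ 2 * c ^ 2 + c ^ 4)"
    unfolding E_w DE unfolding E_def by algebra
  also have "\<dots> = (4 * E ^ 2 * w) * (E ^ 2 * r)"
    unfolding qD_quotient E_w E_r by (rule refl)
  finally have "(4 * E ^ 3) * qD w = (4 * E ^ 3) * (w * r * E)"
    by algebra
  then show ?thesis
    by (subst (asm) mult_cancel_left) (simp add: E_nonzero)
qed

lemma qD_r: "qD r = (r ^ 2 - 1) * E"
proof -
  have "qD (r ^ 2) = qD (1 - 256 * w ^ 2)"
    by (simp add: r_square)
  then have "(2 * r) * qD r = - 512 * w * qD w"
    by simp
  also have "\<dots> = (2 * r) * ((r ^ 2 - 1) * E)"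
    unfolding qD_w r_square by algebra
  finally show ?thesis
    by (subst (asm) mult_cancel_left) (simp add: r_nonzero)
qed

text \<open>Equivalently, f = E^(-1/2) solves D^2 f = -48 w^2 E^2 f. It follows from
  \<open>qD_quotient\<close>, its derivative and \<open>qD_qD_a\<close>.\<close>

lemma E_ode: "2 * E * qD (qD E) - 3 * qD E ^ 2 = 192 * w ^ 2 * E ^ 4"
proof -
  have DE: "qD E = 2 * (a * qD a + c * qD c)"
    by (simp add: E_def algebra_simps)
  have DDE: "qD (qD E) = 2 * (qD a ^ 2 + a * qD (qD a) + qD c ^ 2 + c * qD (qD c))"
    unfolding DE by (simp add: algebra_simps power2_eq_square)
  have "qD (a * qD c - c * qD a) = qD (a * c * (a ^ 2 - c ^ 2))"
    using qD_quotient by simp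
  then have R2: "a * qD (qD c) - c * qD (qD a) =
      (qD a * c + a * qD c) * (a ^ 2 - c ^ 2) + a * c * (2 * a * qD a - 2 * c * qD c)"
    by (simp add: algebra_simps)
  \<comment> \<open>The factor \<open>a ^ 2\<close> makes the derivatives of \<open>c\<close> occur
    through \<open>a * qD c\<close> and \<open>a * qD (qD c)\<close>, which can be expressed by
    derivatives of \<open>a\<close>.\<close>
  have "a ^ 2 * (2 * E * qD (qD E) - 3 * qD E ^ 2) = a ^ 2 * (12 * (a * c * (a ^ 2 - c ^ 2)) ^ 2)"
    unfolding DDE unfolding DE unfolding E_def using qD_quotient R2 qD_qD_a by algebra
  then have "2 * E * qD (qD E) - 3 * qD E ^ 2 = 12 * (a * c * (a ^ 2 - c ^ 2)) ^ 2"
    by (subst (asm) mult_cancel_left) (simp add: a_nonzero)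
  then show ?thesis
    unfolding E_w [symmetric] by algebra
qed

section \<open>The linear equation in w and Ramanujan's series\<close>

text \<open>The derivation \<open>qD F / (r * E)\<close> is \<open>w d/dw\<close>.\<close>

definition dw :: "'a fps \<Rightarrow> 'a fps" where
  "dw F = qD F * inverse r * inverse E"

lemma dw_diff: "dw (F - G) = dw F - dw G"
  by (simp add: dw_def algebra_simps)

text \<open>The chain rule combined with \<open>qD_w\<close>; a common factor \<open>w\<close> is
  cancelled at the end.\<close>

lemma dw_compose: "dw (F oo w) = qD F oo w"
proof -
  have rE: "inverse r * inverse E * (r * E) = 1"
    using E_inverse inverse_mult_eq_1' [of r] by (simp add: r_0) algebra
  have "w * dw (F oo w) = (qD F oo w) * qD w * inverse r * inverse E"
    unfolding dw_def qD_compose [OF w_0, symmetric] by (simp add: mult.assoc)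
  also have "\<dots> = w * (qD F oo w) * (inverse r * inverse E * (r * E))"
    unfolding qD_w by algebra
  finally show ?thesis
    using w_nonzero by (simp add: rE)
qed

text \<open>This is the equation of \<open>central_fps\<close> in the variable \<open>w\<close>,
  with its third-order terms collected: 1 - 4 * 64 w^2 = r^2. All iterates of \<open>dw\<close> on
  \<open>E\<close> are expressed through the logarithmic derivative \<open>P\<close> of
  \<open>E\<close>, whose derivative is known.\<close>

lemma dw_ode: "r ^ 2 * dw (dw (dw E)) = 64 * w ^ 2 * (12 * dw (dw E) + 11 * dw E + 3 * E)"
proof -
  define u v P where "u = inverse r" and "v = inverse E" and "P = qD E * v"
  have ru: "r * u = 1" and Ev: "E * v = 1"
    by (simp_all add: inverse_mult_eq_1' E_0 r_0 u_def v_def)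
  have Du: "qD u = - (u ^ 2) * ((r ^ 2 - 1) * E)"
    unfolding u_def by (subst qD_inverse) (simp_all add: r_0 qD_r)
  have Dv: "qD v = - (v ^ 2) * qD E"
    unfolding v_def by (subst qD_inverse) (simp_all add: E_0)
  have DE: "qD E = P * E"
    using Ev unfolding P_def by algebra
  have "2 * E * E * (qD (qD E) * v + qD E * qD v) = E * v * (2 * E * qD (qD E) - 2 * (qD E) ^ 2 * (E * v))"
    unfolding Dv by algebra
  also have "\<dots> = E ^ 2 * P ^ 2 + 192 * w ^ 2 * E ^ 4"
    using E_ode Ev unfolding DE by algebra
  also have "qD (qD E) * v + qD E * qD v = qD P"
    by (simp add: P_def)
  finally have "E ^ 2 * (4 * (2 * qD P)) = E ^ 2 * (4 * P ^ 2 + 3 * (1 - r ^ 2) * E ^ 2)"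
    unfolding r_square by algebra
  \<comment> \<open>A Riccati equation, obtained by rewriting \<open>E_ode\<close> in terms of
    \<open>P\<close>. The factors 8 here and below clear denominators.\<close>
  then have DP: "8 * qD P = 4 * P ^ 2 + 3 * (1 - r ^ 2) * E ^ 2"
    by (subst (asm) mult_cancel_left) (simp add: E_nonzero)
  have 1: "dw E = P * u"
    unfolding dw_def u_def [symmetric] v_def [symmetric] DE using Ev by algebra
  have "8 * dw (dw E) = (8 * qD P * u + 8 * P * qD u) * u * v"
    unfolding 1 unfolding dw_def u_def [symmetric] v_def [symmetric] by (simp add: algebra_simps)
  also have "\<dots> = 4 * P ^ 2 * u ^ 2 * v + 3 * (u ^ 2 - 1) * E + 8 * P * (u ^ 3 - u)"
    unfolding DP Du using ru Ev by algebra
  finally have 2: "8 * dw (dw E) = 4 * P ^ 2 * u ^ 2 * v + 3 * (u ^ 2 - 1) * E + 8 * P * (u ^ 3 - u)" .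
  have "8 * (8 * dw (dw (dw E))) = 8 * qD (8 * dw (dw E)) * u * v"
    unfolding dw_def u_def [symmetric] v_def [symmetric] by (simp add: algebra_simps)
  also have "\<dots> = (8 * P * (8 * qD P) * u ^ 2 * v + 64 * P ^ 2 * u * qD u * v + 32 * P ^ 2 * u ^ 2 * qD v
      + 48 * u * qD u * E + 24 * (u ^ 2 - 1) * qD E + 8 * (8 * qD P) * (u ^ 3 - u)
      + 64 * P * (3 * u ^ 2 - 1) * qD u) * u * v"
    unfolding 2 by (simp add: power2_eq_square power3_eq_cube algebra_simps)
  also have "\<dots> = 8 * (u ^ 2 - 1) * (6 * P * u + 12 * P ^ 2 * u ^ 2 * v + 6 * E * u ^ 2 + 3 * (u ^ 2 - 1) * E
      + 8 * P * (3 * u ^ 3 - u))"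
    unfolding DP Du Dv DE using ru Ev by algebra
  finally have 3: "8 * (8 * dw (dw (dw E))) = 8 * (u ^ 2 - 1) * (6 * P * u + 12 * P ^ 2 * u ^ 2 * v
      + 6 * E * u ^ 2 + 3 * (u ^ 2 - 1) * E + 8 * P * (3 * u ^ 3 - u))" .
  have "256 * (r ^ 2 * (8 * (8 * dw (dw (dw E))))) =
      64 * (1 - r ^ 2) * (96 * (8 * dw (dw E)) + 704 * dw E + 192 * E)"
    unfolding 3 2 unfolding 1 using ru by algebra
  also have "1 - r ^ 2 = 256 * w ^ 2"
    by (simp add: r_square)
  finally have "16384 * (r ^ 2 * dw (dw (dw E))) =
      16384 * (64 * w ^ 2 * (12 * dw (dw E) + 11 * dw E + 3 * E))"
    by algebra
  then show ?thesis
    by (subst (asm) mult_cancel_left) simp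
qed

text \<open>Ramanujan's series. Both sides solve the same linear equation, whose indicial polynomial
  at \<open>w = 0\<close> is n^3. A nonzero difference of order n forces n^3 = 0, but the constant
  terms agree.\<close>

lemma E_eq_compose: "E = central_fps oo w"
proof (rule ccontr)
  assume neq: "E \<noteq> central_fps oo w"
  define U where "U = E - (central_fps oo w)"
  define n where "n = subdegree U"
  have "U \<noteq> 0" using neq by (simp add: U_def)
  \<comment> \<open>Since \<open>r * E\<close> has constant term 1, \<open>dw\<close> multiplies the
    lowest coefficient of a series by its index.\<close>
  have low: "dw F $ m = of_nat m * F $ m" if "\<And>i. i < m \<Longrightarrow> F $ i = 0" for F m
  proof -
    have "dw F $ m = (\<Sum>i=0..m. of_nat i * F $ i * (inverse r * inverse E) $ (m - i))"
      by (simp add: dw_def mult.assoc fps_mult_nth)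
    also have "\<dots> = (\<Sum>i\<in>{m}. of_nat i * F $ i * (inverse r * inverse E) $ (m - i))"
      using that by (intro sum.mono_neutral_right) auto
    finally show ?thesis
      by (simp add: r_0 E_0)
  qed
  have U_low: "U $ i = 0" if "i < n" for i
    using that by (auto simp: n_def)
  then have U1: "dw U $ i = of_nat i * U $ i" if "i \<le> n" for i
    using that by (intro low) auto
  then have U2: "dw (dw U) $ i = of_nat i ^ 2 * U $ i" if "i \<le> n" for i
    using that U_low by (subst low) (auto simp: power2_eq_square)
  then have U3: "dw (dw (dw U)) $ i = of_nat i ^ 3 * U $ i" if "i \<le> n" for i
    using that U_low by (subst low) (auto simp: power2_eq_square power3_eq_cube)
  have "qD (qD (qD central_fps)) oo w = 64 * w ^ 2 * (4 * (qD (qD (qD central_fps)) oo w) +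
      12 * (qD (qD central_fps) oo w) + 11 * (qD central_fps oo w) + 3 * (central_fps oo w))"
    by (subst central_fps_ode) (simp add: fps_compose_mult_distrib fps_compose_add_distrib fps_X_power_compose w_0)
  then have "r ^ 2 * (qD (qD (qD central_fps)) oo w) =
      64 * w ^ 2 * (12 * (qD (qD central_fps) oo w) + 11 * (qD central_fps oo w) + 3 * (central_fps oo w))"
    unfolding r_square by algebra
  then have "r ^ 2 * dw (dw (dw U)) = 64 * w ^ 2 * (12 * dw (dw U) + 11 * dw U + 3 * U)"
    unfolding U_def dw_diff dw_compose using dw_ode by algebra
  then have "(r ^ 2 * dw (dw (dw U))) $ n = ((12 * dw (dw U) + 11 * dw U + 3 * U) * (64 * w ^ 2)) $ n"
    by (simp add: mult.commute)
  \<comment> \<open>In the convolution, indices below \<open>n\<close> meet zero coefficients of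
    \<open>U\<close> and its derivatives, and index \<open>n\<close> meets the zero constant term of
    \<open>w ^ 2\<close>.\<close>
  also have "\<dots> = 0"
    unfolding fps_mult_nth [of "12 * dw (dw U) + 11 * dw U + 3 * U"]
  proof (intro sum.neutral ballI)
    fix i assume "i \<in> {0..n}"
    then consider "i < n" | "i = n" by fastforce
    then show "(12 * dw (dw U) + 11 * dw U + 3 * U) $ i * (64 * w ^ 2) $ (n - i) = 0"
      by cases (simp_all add: numeral_fps_const U1 U2 U_low w_0 fps_power_zeroth)
  qed
  also have "(r ^ 2 * dw (dw (dw U))) $ n = (\<Sum>i\<in>{n}. (r ^ 2) $ (n - i) * dw (dw (dw U)) $ i)"
    unfolding mult.commute [of "r ^ 2"] fps_mult_nth using U3 U_low
    by (intro sum.mono_neutral_cong_right) auto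
  finally have "n = 0"
    using \<open>U \<noteq> 0\<close> U3 by (simp add: r_0 n_def)
  then have "U $ 0 \<noteq> 0"
    using \<open>U \<noteq> 0\<close> by (metis n_def nth_subdegree_nonzero)
  then show False
    by (simp add: U_def E_0 central_fps_def)
qed


text \<open>By \<open>qD_catalan_fps\<close> and Ramanujan's series,
  \<open>qD catalan_fps oo w\<close> is \<open>w * E\<close>; the chain rule then leaves a factor
  \<open>w\<close> to cancel.\<close>

lemma qD_catalan_compose: "qD (catalan_fps oo w) = E * qD w"
proof -
  have "w * qD (catalan_fps oo w) = w * (E * qD w)"
    unfolding E_eq_compose
    by (subst qD_compose) (simp_all add: w_0 qD_catalan_fps fps_compose_mult_distrib)
  then show ?thesis
    by (simp add: w_nonzero)
qed

text \<open>The closed form that is later matched with the eta quotient for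
  \<open>phi\<close>.\<close>

lemma E_times_qD_w:
  "E * qD w = fps_const (1 / 4) * (a * c * (a ^ 2 - c ^ 2) * (a ^ 4 - 6 * a ^ 2 * c ^ 2 + c ^ 4)) * inverse (a ^ 2 + c ^ 2) ^ 2"
proof -
  have "E * qD w = w * (E ^ 2 * r)"
    unfolding qD_w by algebra
  then show ?thesis
    unfolding E_r unfolding w_def E_def by algebra
qed

end

section \<open>The Jacobi triple product\<close>

text \<open>The symbol (p; p)_n, whose quotients below are Gaussian binomial coefficients.\<close>

definition qpoch :: "'a::field \<Rightarrow> nat \<Rightarrow> 'a" where
  "qpoch p n = (\<Prod>k<n. 1 - p ^ Suc k)"

lemma qpoch_0 [simp]: "qpoch p 0 = 1"
  and qpoch_Suc: "qpoch p (Suc n) = qpoch p n * (1 - p ^ Suc n)"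
  by (simp_all add: qpoch_def)

text \<open>Induction on \<open>n\<close>: the summands obey a q-Pascal rule that matches
  multiplication by the next factor \<open>1 + t * p ^ n\<close>. The hypothesis \<open>nz\<close>
  keeps the denominators nonzero.\<close>

lemma qbinomial_theorem:
  fixes p t :: "'a::field"
  assumes nz: "\<And>n. p ^ Suc n \<noteq> 1"
  shows "(\<Prod>k<n. 1 + t * p ^ k) =
    (\<Sum>k\<le>n. qpoch p n / (qpoch p k * qpoch p (n - k)) * p ^ (k choose 2) * t ^ k)"
proof (induction n)
  case (Suc n)
  have P: "qpoch p m \<noteq> 0" for m
    using nz by (auto simp: qpoch_def)
  define B where "B n k = qpoch p n / (qpoch p k * qpoch p (n - k)) * p ^ (k choose 2) * t ^ k" for n k
  have B0: "B n 0 = 1" for n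
    using P by (simp add: B_def numeral_2_eq_2)
  have last: "B (Suc n) (Suc n) = t * p ^ n * B n n"
    using P by (simp add: B_def numeral_2_eq_2 power_add)
  have pascal: "B (Suc n) (Suc k) = B n (Suc k) + t * p ^ n * B n k" if "k < n" for k
  proof -
    obtain m where n: "n = Suc (k + m)"
      using \<open>k < n\<close> less_iff_Suc_add by auto
    have "1 - p ^ Suc k \<noteq> 0" "1 - p ^ Suc m \<noteq> 0"
      using nz by auto
    moreover have "(Suc k choose 2) = (k choose 2) + k"
      by (simp add: numeral_2_eq_2)
    ultimately show ?thesis
      using P [of k] P [of m] unfolding n B_def
      by (simp add: qpoch_Suc power_add divide_simps del: power_Suc) (simp add: algebra_simps power_add)
  qed
  have "(\<Sum>k\<le>Suc n. B (Suc n) k) = 1 + (\<Sum>k\<le>n. B (Suc n) (Suc k))"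
    by (subst sum.atMost_Suc_shift) (simp add: B0)
  also have "(\<Sum>k\<le>n. B (Suc n) (Suc k)) = (\<Sum>k<n. B (Suc n) (Suc k)) + B (Suc n) (Suc n)"
    by (simp flip: lessThan_Suc_atMost)
  also have "\<dots> = (\<Sum>k<n. B n (Suc k)) + t * p ^ n * (\<Sum>k\<le>n. B n k)"
    by (simp add: pascal last sum.distrib sum_distrib_left distrib_left flip: lessThan_Suc_atMost)
  also have "1 + \<dots> = (1 + t * p ^ n) * (\<Sum>k\<le>n. B n k)"
    using sum.lessThan_Suc_shift [of "B n" n] by (simp add: B0 lessThan_Suc_atMost algebra_simps)
  finally show ?case
    using Suc by (simp add: B_def)
qed (simp add: numeral_2_eq_2)

lemma sum_symmetric_range:
  fixes f :: "nat \<Rightarrow> 'a::comm_monoid_add"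
  shows "(\<Sum>k\<le>2 * n. f k) = f n + (\<Sum>j<n. f (n + Suc j) + f (n - Suc j))"
proof -
  have "{..2 * n} = {..<n} \<union> ({n} \<union> {Suc n..2 * n})"
    by auto
  then have "sum f {..2 * n} = sum f {..<n} + (f n + sum f {Suc n..2 * n})"
    by (simp only:) (subst sum.union_disjoint; auto simp: sum.union_disjoint)+
  also have "sum f {..<n} = (\<Sum>j<n. f (n - Suc j))"
    by (rule sum.nat_diff_reindex [symmetric])
  also have "sum f {Suc n..2 * n} = (\<Sum>j<n. f (n + Suc j))"
    by (rule sum.reindex_bij_witness [of _ "\<lambda>j. n + Suc j" "\<lambda>k. k - Suc n"]) auto
  finally show ?thesis
    by (simp add: sum.distrib ac_simps)
qed

text \<open>The q-binomial theorem with \<open>2 * n\<close> factors in base Q^2. The shift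
  \<open>t\<close> places the exponents symmetrically: the upper half gives the factors in z, the
  lower half those in 1/z, and the sum is recentred at k = n.\<close>

lemma finite_jacobi_triple_product:
  fixes Q z :: "'a::field"
  assumes "Q \<noteq> 0" "z \<noteq> 0" and nz: "\<And>n. (Q ^ 2) ^ Suc n \<noteq> 1"
  defines "p \<equiv> qpoch (Q ^ 2)"
  shows "(\<Prod>i<n. (1 + z * Q ^ (2 * i + 1)) * (1 + Q ^ (2 * i + 1) / z)) =
    p (2 * n) / (p n * p n) +
    (\<Sum>j<n. p (2 * n) / (p (n + Suc j) * p (n - Suc j)) * ((z ^ Suc j + 1 / z ^ Suc j) * Q ^ (Suc j)\<^sup>2))"
proof -
  define t where "t = z * Q / Q ^ (2 * n)"
  \<comment> \<open>The inverse of the product of the factors z / Q^(2 i + 1) pulled out of the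
    lower half.\<close>
  define c where "c = Q ^ n\<^sup>2 / z ^ n"
  have p: "p m \<noteq> 0" for m
    using nz by (auto simp: p_def qpoch_def)
  have low: "(\<Prod>i<n. 1 + t * (Q ^ 2) ^ i) * c = (\<Prod>i<n. 1 + Q ^ (2 * i + 1) / z)"
  proof -
    have "(\<Prod>i<n. 1 + t * (Q ^ 2) ^ i) = (\<Prod>i<n. 1 + t * (Q ^ 2) ^ (n - Suc i))"
      by (rule prod.nat_diff_reindex [symmetric])
    also have "\<dots> = (\<Prod>i<n. z / Q ^ (2 * i + 1) * (1 + Q ^ (2 * i + 1) / z))"
    proof (rule prod.cong)
      fix i assume "i \<in> {..<n}"
      then obtain m where n: "n = Suc (i + m)"
        using less_iff_Suc_add by auto
      show "1 + t * (Q ^ 2) ^ (n - Suc i) = z / Q ^ (2 * i + 1) * (1 + Q ^ (2 * i + 1) / z)"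
        using assms(1,2) by (simp add: t_def n power_mult [symmetric] power_add field_simps power2_eq_square)
          (simp add: mult_2_right power_add)
    qed simp
    also have "\<dots> = (\<Prod>i<n. z / Q ^ (2 * i + 1)) * (\<Prod>i<n. 1 + Q ^ (2 * i + 1) / z)"
      by (rule prod.distrib)
    also have "(\<Prod>i<n. z / Q ^ (2 * i + 1)) = z ^ n / Q ^ n\<^sup>2"
      by (induction n) (simp_all add: power2_eq_square power_add mult_2_right algebra_simps)
    finally show ?thesis
      using assms(1,2) by (simp add: c_def)
  qed
  have high: "(\<Prod>i<n. 1 + t * (Q ^ 2) ^ (n + i)) = (\<Prod>i<n. 1 + z * Q ^ (2 * i + 1))"
    using assms(1,2) by (intro prod.cong) (simp_all add: t_def power_mult [symmetric] power_add)
  have "(\<Prod>i<n. (1 + z * Q ^ (2 * i + 1)) * (1 + Q ^ (2 * i + 1) / z)) = c * (\<Prod>k<2 * n. 1 + t * (Q ^ 2) ^ k)"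
  proof -
    have split: "(\<Prod>k<n + m. g k) = (\<Prod>i<n. g i) * (\<Prod>i<m. g (n + i))" for g :: "nat \<Rightarrow> 'a" and n m
      by (induction m) (simp_all add: mult.assoc)
    have "(\<Prod>k<n + n. 1 + t * (Q ^ 2) ^ k) = (\<Prod>i<n. 1 + t * (Q ^ 2) ^ i) * (\<Prod>i<n. 1 + t * (Q ^ 2) ^ (n + i))"
      using split [of "\<lambda>k. 1 + t * (Q ^ 2) ^ k" n n] .
    then show ?thesis
      unfolding prod.distrib low [symmetric] high by (simp add: mult_2 mult_2_right mult_ac)
  qed
  also have "\<dots> = (\<Sum>k\<le>2 * n. p (2 * n) / (p k * p (2 * n - k)) * (c * (Q ^ 2) ^ (k choose 2) * t ^ k))"
    by (subst qbinomial_theorem) (use nz in \<open>simp_all add: p_def sum_distrib_left mult_ac\<close>)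
  also have "\<dots> = p (2 * n) / (p n * p n) +
    (\<Sum>j<n. p (2 * n) / (p (n + Suc j) * p (n - Suc j)) * ((z ^ Suc j + 1 / z ^ Suc j) * Q ^ (Suc j)\<^sup>2))"
  proof -
    define T where "T k = c * (Q ^ 2) ^ (k choose 2) * t ^ k" for k
    \<comment> \<open>This says T k = z^(k - n) Q^((k - n)^2), multiplied out to avoid negative
      exponents.\<close>
    have T: "T k * z ^ n * Q ^ (2 * n * k) = z ^ k * Q ^ (n\<^sup>2 + k\<^sup>2)" for k
    proof -
      have "2 * (k choose 2) + k = k\<^sup>2"
        by (induction k) (simp_all add: numeral_2_eq_2)
      then have "(Q ^ 2) ^ (k choose 2) * Q ^ k = Q ^ k\<^sup>2"
        by (metis power_add power_mult)
      moreover have "c * z ^ n = Q ^ n\<^sup>2" "t * Q ^ (2 * n) = z * Q"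
        using assms(1,2) by (simp_all add: c_def t_def)
      moreover have "T k * z ^ n * Q ^ (2 * n * k) = (c * z ^ n) * (Q ^ 2) ^ (k choose 2) * (t * Q ^ (2 * n)) ^ k"
        unfolding T_def power_mult [of Q "2 * n" k] power_mult_distrib by (simp only: mult_ac)
      ultimately show ?thesis
        by (simp add: power_mult_distrib power_add mult_ac)
    qed
    have up: "T (n + j) = z ^ j * Q ^ j\<^sup>2" for j
    proof -
      have eq: "n\<^sup>2 + (n + j)\<^sup>2 = 2 * n * (n + j) + j\<^sup>2"
        by (simp add: power2_eq_square algebra_simps)
      have "T (n + j) * (z ^ n * Q ^ (2 * n * (n + j))) = (z ^ j * Q ^ j\<^sup>2) * (z ^ n * Q ^ (2 * n * (n + j)))"
        using T [of "n + j"] unfolding eq power_add by (simp only: mult_ac)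
      then show ?thesis
        using assms(1,2) by simp
    qed
    have down: "T (n - j) = Q ^ j\<^sup>2 / z ^ j" if j: "j \<le> n" for j
    proof -
      obtain m where n: "n = m + j"
        using j by (metis le_add_diff_inverse2)
      have eq: "n\<^sup>2 + m\<^sup>2 = 2 * n * m + j\<^sup>2"
        by (simp add: power2_eq_square algebra_simps n)
      have "T m * z ^ n * Q ^ (2 * n * m) = z ^ m * (Q ^ (2 * n * m) * Q ^ j\<^sup>2)"
        using T [of m] unfolding eq power_add .
      also have "\<dots> = (Q ^ j\<^sup>2 / z ^ j) * z ^ n * Q ^ (2 * n * m)"
        using assms(2) by (simp add: n power_add)
      finally have "T m * (z ^ n * Q ^ (2 * n * m)) = (Q ^ j\<^sup>2 / z ^ j) * (z ^ n * Q ^ (2 * n * m))"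
        by (simp only: mult.assoc)
      then have "T m = Q ^ j\<^sup>2 / z ^ j"
        using assms(1,2) by (subst (asm) mult_cancel_right) simp
      then show ?thesis
        by (simp add: n)
    qed
    have "T n = 1"
      using up [of 0] by simp
    moreover have "p (2 * n) / (p (n + Suc j) * p (2 * n - (n + Suc j))) * T (n + Suc j) +
        p (2 * n) / (p (n - Suc j) * p (2 * n - (n - Suc j))) * T (n - Suc j) =
        p (2 * n) / (p (n + Suc j) * p (n - Suc j)) * ((z ^ Suc j + 1 / z ^ Suc j) * Q ^ (Suc j)\<^sup>2)"
      if "j < n" for j
    proof -
      have "2 * n - (n + Suc j) = n - Suc j" "2 * n - (n - Suc j) = n + Suc j"
        using that by auto
      then show ?thesis
        using that unfolding up by (subst down) (simp_all add: algebra_simps del: power_Suc)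
    qed
    ultimately show ?thesis
      unfolding T_def [symmetric] sum_symmetric_range by simp
  qed
  finally show ?thesis .
qed

section \<open>Infinite products and the limit of the finite identity\<close>

definition euler_prod :: "complex \<Rightarrow> complex" where
  "euler_prod p = (\<Prod>n. 1 - p ^ Suc n)"

lemma power_Suc_neq_1: "p ^ Suc n \<noteq> 1" if "norm p < 1" for p :: "'a::real_normed_field"
proof
  assume "p ^ Suc n = 1"
  then have "norm p ^ Suc n = 1"
    by (metis norm_one norm_power)
  then show False
    using that power_Suc_less_one [of "norm p" n] by (cases "p = 0") auto
qed

lemma convergent_prod_euler:
  assumes "norm (p :: complex) < 1"
  shows "convergent_prod (\<lambda>n. 1 - p ^ Suc n)"
proof -
  have "summable (\<lambda>n. norm p ^ Suc n)"
    using assms by (subst summable_Suc_iff) (simp add: summable_geometric)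
  then have "summable (\<lambda>n. norm ((1 - p ^ Suc n) - 1))"
    by (simp add: norm_power norm_mult)
  then show ?thesis
    by (intro abs_convergent_prod_imp_convergent_prod summable_imp_abs_convergent_prod)
qed

lemma euler_prod_nonzero: "norm p < 1 \<Longrightarrow> euler_prod p \<noteq> 0"
  unfolding euler_prod_def
  using power_Suc_neq_1 [of p] convergent_prod_euler [of p] by (intro prodinf_nonzero) auto

lemma qpoch_tendsto: "norm p < 1 \<Longrightarrow> qpoch p \<longlonglongrightarrow> euler_prod p"
  unfolding qpoch_def euler_prod_def
  using convergent_prod_euler [of p] by (intro has_prod_imp_tendsto' convergent_prod_has_prod)

text \<open>The norm of each term is \<open>(norm z * norm Q ^ Suc j) ^ Suc j\<close>, whose base is
  eventually below 1/2.\<close>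

lemma summable_triple_product:
  fixes Q z :: complex
  assumes "norm Q < 1"
  shows "summable (\<lambda>j. norm (z ^ Suc j * Q ^ (Suc j)\<^sup>2))"
proof -
  have "(\<lambda>j. norm z * norm Q ^ Suc j) \<longlonglongrightarrow> norm z * 0"
    using assms by (intro tendsto_mult tendsto_const LIMSEQ_Suc LIMSEQ_power_zero) auto
  then have "eventually (\<lambda>j. norm z * norm Q ^ Suc j < 1 / 2) sequentially"
    by (rule order_tendstoD) simp
  moreover have "norm (z ^ Suc j * Q ^ (Suc j)\<^sup>2) = (norm z * norm Q ^ Suc j) ^ Suc j" for j
    by (simp add: norm_mult norm_power power_mult_distrib power2_eq_square flip: power_mult power_Suc)
  ultimately have "eventually (\<lambda>j. norm (norm (z ^ Suc j * Q ^ (Suc j)\<^sup>2)) \<le> (1 / 2) ^ Suc j) sequentially"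
    by (auto elim!: eventually_mono intro!: power_mono simp del: power_Suc)
  moreover have "summable (\<lambda>j. (1 / 2 :: real) ^ Suc j)"
    by (subst summable_Suc_iff) (simp add: summable_geometric)
  ultimately show ?thesis
    by (rule summable_comparison_test_ev)
qed

text \<open>Tannery's theorem applied to the finite identity: the coefficients are bounded by
  \<open>K * (L * L)\<close> and tend to \<open>1 / e\<close>. The product stays a limit of partial
  products, the form in which it is evaluated below.\<close>

theorem jacobi_triple_product:
  fixes Q z :: complex
  assumes Q: "Q \<noteq> 0" "norm Q < 1" and z: "z \<noteq> 0"
  shows "(\<lambda>n. \<Prod>i<n. (1 + z * Q ^ (2 * i + 1)) * (1 + Q ^ (2 * i + 1) / z))
    \<longlonglongrightarrow> (1 + (\<Sum>j. (z ^ Suc j + 1 / z ^ Suc j) * Q ^ (Suc j)\<^sup>2)) / euler_prod (Q ^ 2)"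
proof -
  define p where "p = qpoch (Q ^ 2)"
  define e where "e = euler_prod (Q ^ 2)"
  have Q2: "norm (Q ^ 2) < 1"
    using Q by (simp add: norm_power power_less_one_iff)
  have lim: "p \<longlonglongrightarrow> e" and "e \<noteq> 0"
    unfolding p_def e_def using Q2 by (simp_all add: qpoch_tendsto euler_prod_nonzero)
  have p: "p n \<noteq> 0" for n
    using power_Suc_neq_1 [OF Q2] by (auto simp: p_def qpoch_def)
  have "Bseq p" "Bseq (\<lambda>n. inverse (p n))"
    using lim tendsto_inverse [OF lim \<open>e \<noteq> 0\<close>] by (auto intro: convergent_imp_Bseq convergentI)
  then obtain K L where KL: "K > 0" "L > 0" "\<And>n. norm (p n) \<le> K" "\<And>n. norm (inverse (p n)) \<le> L"
    by (metis BseqE)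
  define u where "u = (\<lambda>j. (z ^ Suc j + 1 / z ^ Suc j) * Q ^ (Suc j)\<^sup>2)"
  define v where "v j n = (if j < n then p (2 * n) / (p (n + Suc j) * p (n - Suc j)) * u j else 0)" for j n
  have "summable (\<lambda>j. norm (z ^ Suc j * Q ^ (Suc j)\<^sup>2) + norm ((1 / z) ^ Suc j * Q ^ (Suc j)\<^sup>2))"
    using Q by (intro summable_add summable_triple_product)
  then have sum_u: "summable (\<lambda>j. norm (u j))"
    by (rule summable_comparison_test')
      (use norm_triangle_ineq in \<open>simp add: u_def distrib_right power_divide del: power_Suc\<close>)
  have sub: "(\<lambda>n. p (n - k)) \<longlonglongrightarrow> e" for k
    by (rule LIMSEQ_offset [of _ k]) (simp add: lim)
  have add: "(\<lambda>n. p (n + k)) \<longlonglongrightarrow> e" for k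
    using lim by (rule LIMSEQ_ignore_initial_segment)
  have double: "(\<lambda>n. p (2 * n)) \<longlonglongrightarrow> e"
    using lim by (rule LIMSEQ_subseq_LIMSEQ [of _ _ "\<lambda>n. 2 * n", unfolded o_def]) (simp add: strict_mono_def)
  have "(\<lambda>n. suminf (\<lambda>j. v j n)) \<longlonglongrightarrow> suminf (\<lambda>j. u j / e)"
  proof (rule tannerys_theorem [THEN conjunct2, THEN conjunct2])
    fix j
    have "(\<lambda>n. p (2 * n) / (p (n + Suc j) * p (n - Suc j)) * u j) \<longlonglongrightarrow> e / (e * e) * u j"
      using \<open>e \<noteq> 0\<close> by (intro tendsto_intros add sub double) auto
    moreover have "eventually (\<lambda>n. v j n = p (2 * n) / (p (n + Suc j) * p (n - Suc j)) * u j) sequentially"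
      using eventually_gt_at_top [of j] by eventually_elim (simp add: v_def)
    ultimately show "v j \<longlonglongrightarrow> u j / e"
      using \<open>e \<noteq> 0\<close> by (simp add: tendsto_cong)
  next
    have "norm (v j n) \<le> K * (L * L) * norm (u j)" for j n
    proof -
      have "norm (p (2 * n) * (inverse (p (n + Suc j)) * inverse (p (n - Suc j))) * u j) \<le> K * (L * L) * norm (u j)"
        unfolding norm_mult using KL by (intro mult_mono) auto
      then show ?thesis
        using KL by (simp add: v_def field_simps)
    qed
    then show "eventually (\<lambda>(j, n). norm (v j n) \<le> K * (L * L) * norm (u j)) (at_top \<times>\<^sub>F at_top)"
      by (intro always_eventually) auto
    show "summable (\<lambda>j. K * (L * L) * norm (u j))"
      by (intro summable_mult sum_u)
  qed simp
  then have "(\<lambda>n. p (2 * n) / (p n * p n) + suminf (\<lambda>j. v j n)) \<longlonglongrightarrow> e / (e * e) + suminf (\<lambda>j. u j / e)"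
    using \<open>e \<noteq> 0\<close> by (intro tendsto_intros double lim) auto
  moreover have "p (2 * n) / (p n * p n) + suminf (\<lambda>j. v j n) =
      (\<Prod>i<n. (1 + z * Q ^ (2 * i + 1)) * (1 + Q ^ (2 * i + 1) / z))" for n
  proof -
    have "suminf (\<lambda>j. v j n) = (\<Sum>j<n. v j n)"
      by (rule suminf_finite) (auto simp: v_def)
    also have "\<dots> = (\<Sum>j<n. p (2 * n) / (p (n + Suc j) * p (n - Suc j)) * u j)"
      by (simp add: v_def)
    finally show ?thesis
      using finite_jacobi_triple_product [OF Q(1) z power_Suc_neq_1 [OF Q2], of n]
      by (simp only: p_def u_def)
  qed
  moreover have "e / (e * e) + suminf (\<lambda>j. u j / e) = (1 + suminf u) / e"
    using \<open>e \<noteq> 0\<close> sum_u by (simp add: suminf_divide summable_norm_cancel add_divide_distrib)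
  ultimately show ?thesis
    by (simp only: u_def e_def)
qed

section \<open>Theta functions\<close>

text \<open>This is theta_3 in nome \<open>Q\<close>: the sum of Q^(n^2) over all integers, folded
  by n -> -n.\<close>

definition theta :: "complex \<Rightarrow> complex" where
  "theta Q = 1 + 2 * (\<Sum>j. Q ^ (Suc j)\<^sup>2)"

text \<open>In nome \<open>Q\<close>: \<open>\<theta>\<^sub>2 = 2 Q^(1/4) theta_odd\<close>, the normalisation that gives an integral power series.\<close>

definition theta_odd :: "complex \<Rightarrow> complex" where
  "theta_odd Q = (\<Sum>j. Q ^ (j * (j + 1)))"

section \<open>Product formulas for the theta functions\<close>

lemma power_tower_less_1: "norm (Q ^ Suc n) < 1" if "norm Q < 1" for Q :: complex
  using that power_Suc_less_one [of "norm Q" n] by (cases "Q = 0") (auto simp: norm_power norm_mult)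

lemma tendsto_ratio_prod:
  assumes "\<And>n. f n * qpoch p n = g n" "norm p < 1" "g \<longlonglongrightarrow> x"
  shows "f \<longlonglongrightarrow> x / euler_prod p"
proof -
  have "qpoch p n \<noteq> 0" for n
    using power_Suc_neq_1 [OF assms(2)] by (auto simp: qpoch_def)
  then have "f = (\<lambda>n. g n / qpoch p n)"
    by (simp add: fun_eq_iff field_simps flip: assms(1))
  then show ?thesis
    using assms by (auto intro!: tendsto_divide qpoch_tendsto euler_prod_nonzero)
qed

text \<open>Supplying the factors with even exponents completes the partial product to
  \<open>qpoch Q (2 * n)\<close>.\<close>

lemma prod_one_minus_odd_tendsto:
  assumes "norm Q < 1"
  shows "(\<lambda>n. \<Prod>i<n. 1 - Q ^ (2 * i + 1)) \<longlonglongrightarrow> euler_prod Q / euler_prod (Q ^ 2)"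
proof (rule tendsto_ratio_prod)
  show "(\<Prod>i<n. 1 - Q ^ (2 * i + 1)) * qpoch (Q ^ 2) n = qpoch Q (2 * n)" for n
  proof (induction n)
    case (Suc n)
    have "(Q ^ 2) ^ Suc n = Q ^ Suc (Suc (2 * n))"
      unfolding power_mult [symmetric] by simp
    then have "qpoch Q (2 * Suc n) = qpoch Q (2 * n) * (1 - Q ^ (2 * n + 1)) * (1 - (Q ^ 2) ^ Suc n)"
      by (simp add: qpoch_Suc)
    then show ?case
      unfolding prod.lessThan_Suc qpoch_Suc [of "Q ^ 2"] Suc [symmetric] by (simp only: mult_ac)
  qed simp
  show "norm (Q ^ 2) < 1"
    using power_tower_less_1 [OF assms, of 1] by (simp add: power2_eq_square)
  show "(\<lambda>n. qpoch Q (2 * n)) \<longlonglongrightarrow> euler_prod Q"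
    using qpoch_tendsto [OF assms]
    by (rule LIMSEQ_subseq_LIMSEQ [of _ _ "\<lambda>n. 2 * n", unfolded o_def]) (simp add: strict_mono_def)
qed

text \<open>Write 1 + x = (1 - x^2) / (1 - x) and use the previous limit at Q and at Q^2.\<close>

lemma prod_one_plus_odd_tendsto:
  assumes "norm Q < 1"
  shows "(\<lambda>n. \<Prod>i<n. 1 + Q ^ (2 * i + 1)) \<longlonglongrightarrow> euler_prod (Q ^ 2) ^ 2 / (euler_prod Q * euler_prod (Q ^ 4))"
proof -
  have less: "norm (Q ^ 2) < 1" "norm (Q ^ 4) < 1"
    using power_tower_less_1 [OF assms, of 1] power_tower_less_1 [OF assms, of 3] by (simp_all add: eval_nat_numeral)
  have "(\<lambda>n. (\<Prod>i<n. 1 - (Q ^ 2) ^ (2 * i + 1)) / (\<Prod>i<n. 1 - Q ^ (2 * i + 1))) \<longlonglongrightarrow>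
      (euler_prod (Q ^ 2) / euler_prod ((Q ^ 2) ^ 2)) / (euler_prod Q / euler_prod (Q ^ 2))"
    using assms less by (intro tendsto_divide prod_one_minus_odd_tendsto) (auto simp: euler_prod_nonzero)
  moreover have "(\<Prod>i<n. 1 - (Q ^ 2) ^ (2 * i + 1)) / (\<Prod>i<n. 1 - Q ^ (2 * i + 1)) = (\<Prod>i<n. 1 + Q ^ (2 * i + 1))" for n
  proof -
    have "1 - (Q ^ 2) ^ (2 * i + 1) = (1 + Q ^ (2 * i + 1)) * (1 - Q ^ (2 * i + 1))" for i
      by (simp add: power_mult [symmetric] algebra_simps power2_eq_square power_mult_distrib)
    moreover have "1 - Q ^ (2 * i + 1) \<noteq> 0" for i
      using power_Suc_neq_1 [OF assms, of "2 * i"] by simp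
    ultimately show ?thesis
      by (simp flip: prod_dividef del: power_Suc)
  qed
  moreover have "(b / d) / (a / b) = b ^ 2 / (a * d)" for a b d :: complex
    by (simp add: power2_eq_square)
  moreover have "(Q ^ 2) ^ 2 = Q ^ 4"
    by (simp flip: power_mult)
  ultimately show ?thesis
    by (simp only:)
qed

lemma prod_one_plus_even_tendsto:
  assumes "norm Q < 1"
  shows "(\<lambda>n. \<Prod>i<n. 1 + Q ^ (2 * Suc i)) \<longlonglongrightarrow> euler_prod (Q ^ 4) / euler_prod (Q ^ 2)"
proof (rule tendsto_ratio_prod)
  show less: "norm (Q ^ 2) < 1"
    using power_tower_less_1 [OF assms, of 1] by (simp add: power2_eq_square)
  show "(\<Prod>i<n. 1 + Q ^ (2 * Suc i)) * qpoch (Q ^ 2) n = qpoch (Q ^ 4) n" for n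
  proof (induction n)
    case (Suc n)
    have "(1 + Q ^ (2 * Suc n)) * (1 - (Q ^ 2) ^ Suc n) = 1 - (Q ^ 4) ^ Suc n"
    proof -
      have "(Q ^ 4) ^ Suc n = Q ^ (2 * Suc n) * Q ^ (2 * Suc n)"
        unfolding power_mult [symmetric] power_add [symmetric] by (intro arg_cong [of _ _ "power Q"]) simp
      then show ?thesis
        by (simp only: power_mult [symmetric]) (simp add: algebra_simps del: power_Suc mult_Suc_right)
    qed
    then have "(\<Prod>i<n. 1 + Q ^ (2 * Suc i)) * qpoch (Q ^ 2) n * ((1 + Q ^ (2 * Suc n)) * (1 - (Q ^ 2) ^ Suc n))
        = qpoch (Q ^ 4) n * (1 - (Q ^ 4) ^ Suc n)"
      using Suc by presburger
    then show ?case
      by (simp only: prod.lessThan_Suc qpoch_Suc mult_ac)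
  qed simp
  show "qpoch (Q ^ 4) \<longlonglongrightarrow> euler_prod (Q ^ 4)"
    using power_tower_less_1 [OF assms, of 3] by (intro qpoch_tendsto) (simp add: eval_nat_numeral)
qed

text \<open>The triple product at z = 1, where its two kinds of factors coincide and form a
  square.\<close>

lemma theta_eq_euler_prod:
  assumes "Q \<noteq> 0" "norm Q < 1"
  shows "theta Q = euler_prod (Q ^ 2) ^ 5 / (euler_prod Q ^ 2 * euler_prod (Q ^ 4) ^ 2)"
proof -
  have nz: "euler_prod (Q ^ 2) \<noteq> 0"
    using power_tower_less_1 [OF assms(2), of 1] by (intro euler_prod_nonzero) (simp add: power2_eq_square)
  have "(\<lambda>n. \<Prod>i<n. (1 + 1 * Q ^ (2 * i + 1)) * (1 + Q ^ (2 * i + 1) / 1)) \<longlonglongrightarrow>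
      (1 + (\<Sum>j. (1 ^ Suc j + 1 / 1 ^ Suc j) * Q ^ (Suc j)\<^sup>2)) / euler_prod (Q ^ 2)"
    using assms by (intro jacobi_triple_product) auto
  moreover have "(\<Sum>j. (1 ^ Suc j + 1 / 1 ^ Suc j) * Q ^ (Suc j)\<^sup>2) = 2 * (\<Sum>j. Q ^ (Suc j)\<^sup>2)"
    using summable_triple_product [OF assms(2), of 1]
    by (simp add: suminf_mult summable_norm_cancel)
  ultimately have "(\<lambda>n. (\<Prod>i<n. 1 + Q ^ (2 * i + 1)) ^ 2) \<longlonglongrightarrow> theta Q / euler_prod (Q ^ 2)"
    by (simp add: theta_def prod.distrib power2_eq_square)
  moreover have "(\<lambda>n. (\<Prod>i<n. 1 + Q ^ (2 * i + 1)) ^ 2) \<longlonglongrightarrow>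
      (euler_prod (Q ^ 2) ^ 2 / (euler_prod Q * euler_prod (Q ^ 4))) ^ 2"
    by (intro tendsto_power prod_one_plus_odd_tendsto assms)
  ultimately have "theta Q / euler_prod (Q ^ 2) = (euler_prod (Q ^ 2) ^ 2 / (euler_prod Q * euler_prod (Q ^ 4))) ^ 2"
    by (rule LIMSEQ_unique)
  then have "theta Q = (euler_prod (Q ^ 2) ^ 2 / (euler_prod Q * euler_prod (Q ^ 4))) ^ 2 * euler_prod (Q ^ 2)"
    using nz by (simp add: field_simps)
  then show ?thesis
    by (simp add: power_divide power_mult_distrib flip: power_mult) (simp add: eval_nat_numeral)
qed

text \<open>Again z = 1, now in nome -Q: odd powers change sign, while \<open>Q ^ 2\<close> is
  unchanged.\<close>

lemma theta_minus_eq_euler_prod: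
  assumes "Q \<noteq> 0" "norm Q < 1"
  shows "theta (- Q) = euler_prod Q ^ 2 / euler_prod (Q ^ 2)"
proof -
  have nz: "euler_prod (Q ^ 2) \<noteq> 0"
    using power_tower_less_1 [OF assms(2), of 1] by (intro euler_prod_nonzero) (simp add: power2_eq_square)
  have "(\<lambda>n. \<Prod>i<n. (1 + 1 * (- Q) ^ (2 * i + 1)) * (1 + (- Q) ^ (2 * i + 1) / 1)) \<longlonglongrightarrow>
      (1 + (\<Sum>j. (1 ^ Suc j + 1 / 1 ^ Suc j) * (- Q) ^ (Suc j)\<^sup>2)) / euler_prod ((- Q) ^ 2)"
    using assms by (intro jacobi_triple_product) auto
  moreover have "(\<Sum>j. (1 ^ Suc j + 1 / 1 ^ Suc j) * (- Q) ^ (Suc j)\<^sup>2) = 2 * (\<Sum>j. (- Q) ^ (Suc j)\<^sup>2)"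
    using summable_triple_product [of "- Q" 1] assms(2)
    by (simp add: suminf_mult summable_norm_cancel)
  ultimately have "(\<lambda>n. (\<Prod>i<n. 1 - Q ^ (2 * i + 1)) ^ 2) \<longlonglongrightarrow> theta (- Q) / euler_prod (Q ^ 2)"
    by (simp add: theta_def prod.distrib power2_eq_square)
  moreover have "(\<lambda>n. (\<Prod>i<n. 1 - Q ^ (2 * i + 1)) ^ 2) \<longlonglongrightarrow> (euler_prod Q / euler_prod (Q ^ 2)) ^ 2"
    by (intro tendsto_power prod_one_minus_odd_tendsto assms)
  ultimately have "theta (- Q) / euler_prod (Q ^ 2) = (euler_prod Q / euler_prod (Q ^ 2)) ^ 2"
    by (rule LIMSEQ_unique)
  then show ?thesis
    using nz by (simp add: field_simps power2_eq_square)
qed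

lemma summable_theta_odd:
  assumes "norm (Q :: complex) < 1"
  shows "summable (\<lambda>j. Q ^ (j * (j + 1)))"
proof (cases "Q = 0")
  case False
  have "summable (\<lambda>j. Q ^ Suc j * Q ^ (Suc j)\<^sup>2)"
    using summable_triple_product [OF assms, of Q] by (rule summable_norm_cancel)
  moreover have "Suc j * (Suc j + 1) = Suc j + (Suc j)\<^sup>2" for j
    by (simp add: power2_eq_square)
  ultimately have "summable (\<lambda>j. Q ^ (Suc j * (Suc j + 1)))"
    by (simp only: power_add)
  then show ?thesis
    by (subst (asm) summable_Suc_iff)
qed (simp add: power_0_left summable_finite [of "{0}"])

text \<open>The triple product at z = Q: each summand becomes Q^((j+1)(j+2)) + Q^(j(j+1)), so the
  series is counted twice.\<close>

lemma theta_odd_eq_euler_prod: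
  assumes "Q \<noteq> 0" "norm Q < 1"
  shows "theta_odd Q = euler_prod (Q ^ 4) ^ 2 / euler_prod (Q ^ 2)"
proof -
  have nz: "euler_prod (Q ^ 2) \<noteq> 0"
    using power_tower_less_1 [OF assms(2), of 1] by (intro euler_prod_nonzero) (simp add: power2_eq_square)
  have "(\<lambda>n. \<Prod>i<n. (1 + Q * Q ^ (2 * i + 1)) * (1 + Q ^ (2 * i + 1) / Q)) \<longlonglongrightarrow>
      (1 + (\<Sum>j. (Q ^ Suc j + 1 / Q ^ Suc j) * Q ^ (Suc j)\<^sup>2)) / euler_prod (Q ^ 2)"
    using assms by (intro jacobi_triple_product) auto
  also have "1 + (\<Sum>j. (Q ^ Suc j + 1 / Q ^ Suc j) * Q ^ (Suc j)\<^sup>2) = 2 * theta_odd Q"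
  proof -
    define f where "f = (\<lambda>j. Q ^ (j * (j + 1)))"
    have f: "summable f"
      unfolding f_def by (rule summable_theta_odd) fact
    have "(Q ^ Suc j + 1 / Q ^ Suc j) * Q ^ (Suc j)\<^sup>2 = f (Suc j) + f j" for j
    proof -
      have "Q ^ (Suc j)\<^sup>2 = f j * Q ^ Suc j"
        unfolding f_def power_add [symmetric]
        by (intro arg_cong [of _ _ "power Q"]) (simp add: power2_eq_square)
      moreover have "Q ^ Suc j * Q ^ (Suc j)\<^sup>2 = f (Suc j)"
        unfolding f_def power_add [symmetric]
        by (intro arg_cong [of _ _ "power Q"]) (simp add: power2_eq_square)
      ultimately show ?thesis
        using assms by (simp add: distrib_right)
    qed
    then have "(\<Sum>j. (Q ^ Suc j + 1 / Q ^ Suc j) * Q ^ (Suc j)\<^sup>2) = (\<Sum>j. f (Suc j)) + suminf f"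
      using f by (simp add: suminf_add summable_Suc_iff del: power_Suc)
    also have "(\<Sum>j. f (Suc j)) = suminf f - 1"
      using suminf_split_head [OF f] by (simp add: f_def)
    finally show ?thesis
      by (simp add: theta_odd_def f_def)
  qed
  finally have "(\<lambda>n. \<Prod>i<n. (1 + Q ^ (2 * Suc i)) * (1 + Q ^ (2 * i))) \<longlonglongrightarrow> 2 * theta_odd Q / euler_prod (Q ^ 2)"
    using assms by simp
  \<comment> \<open>The shift to \<open>Suc n\<close> exposes the factor
    \<open>1 + Q ^ 0 = 2\<close>, which cancels the 2 in front of
    \<open>theta_odd Q\<close>.\<close>
  then have "(\<lambda>n. \<Prod>i<Suc n. (1 + Q ^ (2 * Suc i)) * (1 + Q ^ (2 * i))) \<longlonglongrightarrow> 2 * theta_odd Q / euler_prod (Q ^ 2)"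
    by (rule LIMSEQ_Suc)
  moreover have "(\<Prod>i<Suc n. (1 + Q ^ (2 * Suc i)) * (1 + Q ^ (2 * i))) =
      2 * ((\<Prod>i<Suc n. 1 + Q ^ (2 * Suc i)) * (\<Prod>i<n. 1 + Q ^ (2 * Suc i)))" for n
    unfolding prod.distrib prod.lessThan_Suc_shift [of "\<lambda>i. 1 + Q ^ (2 * i)"] by simp
  moreover have "(\<lambda>n. 2 * ((\<Prod>i<Suc n. 1 + Q ^ (2 * Suc i)) * (\<Prod>i<n. 1 + Q ^ (2 * Suc i)))) \<longlonglongrightarrow>
      2 * ((euler_prod (Q ^ 4) / euler_prod (Q ^ 2)) * (euler_prod (Q ^ 4) / euler_prod (Q ^ 2)))"
    by (intro tendsto_mult tendsto_const LIMSEQ_Suc [OF prod_one_plus_even_tendsto] prod_one_plus_even_tendsto assms)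
  ultimately have "2 * theta_odd Q / euler_prod (Q ^ 2) =
      2 * ((euler_prod (Q ^ 4) / euler_prod (Q ^ 2)) * (euler_prod (Q ^ 4) / euler_prod (Q ^ 2)))"
    using LIMSEQ_unique by (simp only:) blast
  then show ?thesis
    using nz by (simp add: field_simps power2_eq_square)
qed

text \<open>Classically theta_2(Q)^2 = 2 theta_2(Q^2) theta_3(Q^2). The product formulas reduce it
  to a cancellation of Euler products; Q = 0 is checked directly.\<close>

lemma theta_odd_square:
  assumes "norm Q < 1"
  shows "theta_odd Q ^ 2 = theta (Q ^ 2) * theta_odd (Q ^ 2)"
proof (cases "Q = 0")
  case True
  have "(\<Sum>j. if j = 0 then 1 else 0 :: complex) = 1"
    using sums_single [of 0 "\<lambda>_. 1 :: complex"] by (simp add: sums_iff)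
  then show ?thesis
    by (simp add: True theta_def theta_odd_def power_0_left)
next
  case False
  have less: "norm (Q ^ 2) < 1" "norm (Q ^ 4) < 1" "norm (Q ^ 8) < 1"
    using power_tower_less_1 [OF assms, of 1] power_tower_less_1 [OF assms, of 3]
      power_tower_less_1 [OF assms, of 7] by (simp_all add: eval_nat_numeral)
  have "theta (Q ^ 2) = euler_prod (Q ^ 4) ^ 5 / (euler_prod (Q ^ 2) ^ 2 * euler_prod (Q ^ 8) ^ 2)"
    "theta_odd (Q ^ 2) = euler_prod (Q ^ 8) ^ 2 / euler_prod (Q ^ 4)"
    using False less by (simp_all add: theta_eq_euler_prod theta_odd_eq_euler_prod flip: power_mult)
  moreover have *: "(x\<^sup>2 / y)\<^sup>2 = x ^ 5 / (y\<^sup>2 * w\<^sup>2) * (w\<^sup>2 / x)" if "x \<noteq> 0" "w \<noteq> 0" for x y w :: complex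
    using that by (simp add: field_simps eval_nat_numeral)
  ultimately show ?thesis
    using * [of "euler_prod (Q ^ 4)" "euler_prod (Q ^ 8)" "euler_prod (Q ^ 2)"] less [THEN euler_prod_nonzero]
      theta_odd_eq_euler_prod [OF False assms] by simp
qed

text \<open>Sort the squares by parity: (2 j + 1)^2 = 4 j (j + 1) + 1 and (2 j + 2)^2 = 4 (j +
  1)^2.\<close>

lemma theta_split:
  assumes "norm Q < 1"
  shows "theta Q = theta (Q ^ 4) + 2 * Q * theta_odd (Q ^ 4)"
proof -
  have less: "norm (Q ^ 4) < 1"
    using power_tower_less_1 [OF assms, of 3] by (simp add: eval_nat_numeral)
  have sm: "summable (\<lambda>j. Q ^ (Suc j)\<^sup>2)" if "norm Q < 1" for Q :: complex
    using summable_triple_product [OF that, of 1] by (auto dest: summable_norm_cancel)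
  have "(\<lambda>j. Q * (Q ^ 4) ^ (j * (j + 1)) + (Q ^ 4) ^ (Suc j)\<^sup>2) sums (\<Sum>j. Q ^ (Suc j)\<^sup>2)"
  proof -
    have "Q ^ (Suc (j * 2))\<^sup>2 = Q * (Q ^ 4) ^ (j * (j + 1))" "Q ^ (Suc (Suc (j * 2)))\<^sup>2 = (Q ^ 4) ^ (Suc j)\<^sup>2" for j
    proof -
      have "(Suc (j * 2))\<^sup>2 = Suc (4 * (j * (j + 1)))" "(Suc (Suc (j * 2)))\<^sup>2 = 4 * (Suc j)\<^sup>2"
        by (simp_all add: power2_eq_square)
      then show "Q ^ (Suc (j * 2))\<^sup>2 = Q * (Q ^ 4) ^ (j * (j + 1))"
        "Q ^ (Suc (Suc (j * 2)))\<^sup>2 = (Q ^ 4) ^ (Suc j)\<^sup>2"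
        by (simp_all only: power_mult power_Suc)
    qed
    moreover have "{j * 2..<j * 2 + 2} = {j * 2, Suc (j * 2)}" for j :: nat
      by auto
    ultimately show ?thesis
      using sums_group [OF summable_sums [OF sm [OF assms]], of 2] by simp
  qed
  moreover have "(\<lambda>j. Q * (Q ^ 4) ^ (j * (j + 1)) + (Q ^ 4) ^ (Suc j)\<^sup>2) sums
      (Q * theta_odd (Q ^ 4) + (\<Sum>j. (Q ^ 4) ^ (Suc j)\<^sup>2))"
    unfolding theta_odd_def
    using sm [OF less] summable_theta_odd [OF less] by (intro sums_add sums_mult summable_sums)
  ultimately have "(\<Sum>j. Q ^ (Suc j)\<^sup>2) = Q * theta_odd (Q ^ 4) + (\<Sum>j. (Q ^ 4) ^ (Suc j)\<^sup>2)"
    by (rule sums_unique2)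
  then show ?thesis
    by (simp add: theta_def algebra_simps)
qed

section \<open>Power series of the theta functions\<close>

lemma has_fps_expansion_indicator:
  assumes "strict_mono g"
  shows "(\<lambda>Q. \<Sum>j. Q ^ g j :: complex) has_fps_expansion Abs_fps (\<lambda>n. if n \<in> range g then 1 else 0)"
proof (rule has_fps_expansionI)
  have "(\<lambda>n. (if n \<in> range g then 1 else 0) * Q ^ n) sums (\<Sum>j. Q ^ g j)" if "norm Q < 1" for Q :: complex
  proof -
    have "summable (\<lambda>n. (if n \<in> range g then 1 else 0) * Q ^ n)"
      using that by (intro summable_comparison_test' [OF summable_geometric [of "norm Q"]])
        (auto simp: norm_mult norm_power)
    moreover have "(\<lambda>j. Q ^ g j) sums c \<longleftrightarrow> (\<lambda>n. (if n \<in> range g then 1 else 0) * Q ^ n) sums c" for c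
      using sums_mono_reindex [OF assms, of "\<lambda>n. (if n \<in> range g then 1 else 0) * Q ^ n" c] by simp
    ultimately show ?thesis
      by (metis sums_unique summable_sums)
  qed
  moreover have "eventually (\<lambda>Q :: complex. norm Q < 1) (nhds 0)"
    using eventually_nhds_in_open [of "ball 0 1" "0 :: complex"] by simp
  ultimately show "eventually (\<lambda>Q :: complex. (\<lambda>n. Abs_fps (\<lambda>n. if n \<in> range g then 1 else 0) $ n * Q ^ n)
      sums (\<Sum>j. Q ^ g j)) (nhds 0)"
    by (auto elim!: eventually_mono)
qed

definition theta_fps :: "complex fps" where
  "theta_fps = 1 + 2 * Abs_fps (\<lambda>n. if n \<in> range (\<lambda>j. (Suc j)\<^sup>2) then 1 else 0)"

definition theta_odd_fps :: "complex fps" where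
  "theta_odd_fps = Abs_fps (\<lambda>n. if n \<in> range (\<lambda>j. j * (j + 1)) then 1 else 0)"

lemma theta_has_fps_expansion: "theta has_fps_expansion theta_fps"
proof -
  have "strict_mono (\<lambda>j. (Suc j)\<^sup>2)"
    by (auto simp: strict_mono_def intro!: power_strict_mono)
  then show ?thesis
    unfolding theta_def [abs_def] theta_fps_def
    by (intro fps_expansion_intros has_fps_expansion_indicator)
qed

lemma theta_odd_has_fps_expansion: "theta_odd has_fps_expansion theta_odd_fps"
proof -
  have "strict_mono (\<lambda>j::nat. j * (j + 1))"
    by (auto simp: strict_mono_Suc_iff)
  then show ?thesis
    unfolding theta_odd_def [abs_def] theta_odd_fps_def
    by (intro has_fps_expansion_indicator)
qed

lemma theta_fps_0: "theta_fps $ 0 = 1" and theta_odd_fps_0: "theta_odd_fps $ 0 = 1"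
  by (auto simp: theta_fps_def theta_odd_fps_def)

lemma int_theta_fps: "int_fps theta_fps"
  unfolding theta_fps_def by (intro int_fps_intros; auto simp: int_fps_def)

lemma int_theta_odd_fps: "int_fps theta_odd_fps"
  by (auto simp: theta_odd_fps_def int_fps_def)

section \<open>Theta identities as identities of power series\<close>

lemma has_fps_expansion_square_arg:
  "f has_fps_expansion F \<Longrightarrow> (\<lambda>q. f (q ^ 2) :: complex) has_fps_expansion (F oo fps_X ^ 2)"
  using has_fps_expansion_compose [of f F "\<lambda>q. q ^ 2" "fps_X ^ 2"]
  by (auto simp: o_def intro!: fps_expansion_intros)

lemma eventually_norm_less_1: "eventually (\<lambda>q :: complex. norm q < 1) (nhds 0)"
  using eventually_nhds_in_open [of "ball 0 1" "0 :: complex"] by simp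

lemma fps_eqI_eventually:
  fixes F G :: "complex fps"
  assumes "f has_fps_expansion F" "g has_fps_expansion G" "\<And>q. norm q < 1 \<Longrightarrow> f q = g q"
  shows "F = G"
proof -
  have "eventually (\<lambda>q. f q = g q) (nhds 0)"
    using eventually_norm_less_1 assms(3) by (auto elim!: eventually_mono)
  then have "f has_fps_expansion F \<longleftrightarrow> g has_fps_expansion F"
    by (intro has_fps_expansion_cong) auto
  with assms show ?thesis
    by (metis fps_expansion_unique_complex)
qed

lemma theta_odd_fps_square: "theta_odd_fps ^ 2 = (theta_fps oo fps_X ^ 2) * (theta_odd_fps oo fps_X ^ 2)"
proof (rule fps_eqI_eventually)
  show "(\<lambda>q. theta_odd q ^ 2) has_fps_expansion theta_odd_fps ^ 2"
    by (intro fps_expansion_intros theta_odd_has_fps_expansion)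
  show "(\<lambda>q. theta (q ^ 2) * theta_odd (q ^ 2)) has_fps_expansion
      (theta_fps oo fps_X ^ 2) * (theta_odd_fps oo fps_X ^ 2)"
    by (intro fps_expansion_intros has_fps_expansion_square_arg theta_has_fps_expansion
        theta_odd_has_fps_expansion)
qed (rule theta_odd_square)

lemma theta_fps_split:
  "theta_fps = ((theta_fps oo fps_X ^ 2) oo fps_X ^ 2) + 2 * fps_X * ((theta_odd_fps oo fps_X ^ 2) oo fps_X ^ 2)"
proof (rule fps_eqI_eventually [OF theta_has_fps_expansion])
  show "(\<lambda>q. theta ((q ^ 2) ^ 2) + 2 * q * theta_odd ((q ^ 2) ^ 2)) has_fps_expansion
      ((theta_fps oo fps_X ^ 2) oo fps_X ^ 2) + 2 * fps_X * ((theta_odd_fps oo fps_X ^ 2) oo fps_X ^ 2)"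
    by (intro fps_expansion_intros has_fps_expansion_square_arg [of "\<lambda>q. theta (q ^ 2)"]
      has_fps_expansion_square_arg [of "\<lambda>q. theta_odd (q ^ 2)"]
      has_fps_expansion_square_arg theta_has_fps_expansion theta_odd_has_fps_expansion)
  show "theta q = theta ((q ^ 2) ^ 2) + 2 * q * theta_odd ((q ^ 2) ^ 2)" if "norm q < 1" for q
    using theta_split [OF that] by (simp flip: power_mult)
qed

text \<open>Squaring \<open>theta_fps_split\<close> shows that the defect satisfies N(q) = - N(q^2).
  A nonzero \<open>N\<close> would then have order 0, but its constant term vanishes.\<close>

lemma theta_fps_double:
  "theta_fps ^ 2 = (theta_fps oo fps_X ^ 2) ^ 2 + 4 * fps_X * (theta_odd_fps oo fps_X ^ 2) ^ 2"
proof -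
  define N where "N = theta_fps ^ 2 - (theta_fps oo fps_X ^ 2) ^ 2 - 4 * fps_X * (theta_odd_fps oo fps_X ^ 2) ^ 2"
  define t1 t2 s1 s2 where defs: "t1 = theta_fps oo fps_X ^ 2" "t2 = t1 oo fps_X ^ 2"
    "s1 = theta_odd_fps oo fps_X ^ 2" "s2 = s1 oo fps_X ^ 2"
  have s: "s1 ^ 2 = t2 * s2"
    using arg_cong [OF theta_odd_fps_square, of "\<lambda>F. F oo fps_X ^ 2"]
    by (simp add: defs fps_compose_mult_distrib fps_compose_power)
  have N1: "N oo fps_X ^ 2 = t1 ^ 2 - t2 ^ 2 - 4 * fps_X ^ 2 * s2 ^ 2"
    by (simp add: N_def defs fps_compose_sub_distrib fps_compose_mult_distrib fps_compose_power)
  have "theta_fps = t2 + 2 * fps_X * s2"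
    using theta_fps_split by (simp add: defs)
  then have "N = (t2 + 2 * fps_X * s2) ^ 2 - t1 ^ 2 - 4 * fps_X * s1 ^ 2"
    by (simp add: N_def defs)
  also have "\<dots> = - (N oo fps_X ^ 2)"
    unfolding s N1 by algebra
  finally have N: "N = - (N oo fps_X ^ 2)" .
  then have "subdegree N = 2 * subdegree N"
    by (metis subdegree_uminus subdegree_compose_X2)
  moreover have "N $ 0 = 0"
    by (simp add: N_def theta_fps_0 fps_power_zeroth)
  ultimately have "N = 0"
    by (metis nth_subdegree_nonzero mult_2 add_cancel_right_right)
  then show ?thesis
    unfolding N_def by algebra
qed

text \<open>The doubling equations are \<open>theta_fps_double\<close> and the square of
  \<open>theta_odd_fps_square\<close>, both at q^2. With nome q^2 the square of theta_2 is a power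
  series in q, without fractional exponents.\<close>

interpretation theta: theta_pair "(theta_fps oo fps_X ^ 2) ^ 2" "4 * fps_X * (theta_odd_fps oo fps_X ^ 2) ^ 2"
proof
  define t1 t2 s1 s2 where defs: "t1 = theta_fps oo fps_X ^ 2" "t2 = t1 oo fps_X ^ 2"
    "s1 = theta_odd_fps oo fps_X ^ 2" "s2 = s1 oo fps_X ^ 2"
  have s: "s1 ^ 2 = t2 * s2"
    using arg_cong [OF theta_odd_fps_square, of "\<lambda>F. F oo fps_X ^ 2"]
    by (simp add: defs fps_compose_mult_distrib fps_compose_power)
  have t: "t1 ^ 2 = t2 ^ 2 + 4 * fps_X ^ 2 * s2 ^ 2"
    using arg_cong [OF theta_fps_double, of "\<lambda>F. F oo fps_X ^ 2"]
    by (simp add: defs fps_compose_add_distrib fps_compose_mult_distrib fps_compose_power)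
  show "(theta_fps oo fps_X ^ 2) ^ 2 $ 0 = 1"
    by (simp add: theta_fps_0 fps_power_zeroth)
  show "(4 * fps_X * (theta_odd_fps oo fps_X ^ 2) ^ 2) $ 0 = 0"
    by simp
  show "(4 * fps_X * (theta_odd_fps oo fps_X ^ 2) ^ 2) $ 1 = 4"
    by (simp add: theta_odd_fps_0 fps_power_zeroth fps_mult_nth_1)
  show "(theta_fps oo fps_X ^ 2) ^ 2 =
      ((theta_fps oo fps_X ^ 2) ^ 2 oo fps_X ^ 2) + (4 * fps_X * (theta_odd_fps oo fps_X ^ 2) ^ 2 oo fps_X ^ 2)"
    using t by (simp add: defs fps_compose_mult_distrib fps_compose_power)
  have "(4 * fps_X * s1 ^ 2) ^ 2 = 4 * t2 ^ 2 * (4 * fps_X ^ 2 * s2 ^ 2)"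
    unfolding s by algebra
  then show "(4 * fps_X * (theta_odd_fps oo fps_X ^ 2) ^ 2) ^ 2 =
      4 * ((theta_fps oo fps_X ^ 2) ^ 2 oo fps_X ^ 2) * (4 * fps_X * (theta_odd_fps oo fps_X ^ 2) ^ 2 oo fps_X ^ 2)"
    by (simp add: defs fps_compose_mult_distrib fps_compose_power)
qed

section \<open>The power series of phi: integrality and parity\<close>

definition phi_fps :: "complex fps" where
  "phi_fps = theta.E * qD theta.w"

text \<open>The 4 in the second theta series cancels the 1/4 in \<open>w\<close>, and
  \<open>E\<close> has constant term 1, so its inverse is integral.\<close>

lemma int_w: "int_fps theta.w"
proof -
  define a s where "a = theta_fps oo fps_X ^ 2" and "s = theta_odd_fps oo fps_X ^ 2"
  have ints: "int_fps a" "int_fps s"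
    by (simp_all add: a_def s_def int_fps_intros int_theta_fps int_theta_odd_fps)
  have "fps_const (1 / 4 :: complex) * 4 = 1"
    by (simp add: numeral_fps_const)
  then have "theta.w = a ^ 2 * (fps_X * s ^ 2) * ((a ^ 2) ^ 2 - (4 * fps_X * s ^ 2) ^ 2) * inverse theta.E ^ 2"
    unfolding theta.w_def a_def s_def by algebra
  moreover have "int_fps theta.E"
    unfolding theta.E_def by (intro int_fps_intros int_theta_fps int_theta_odd_fps)
  ultimately show ?thesis
    by (auto intro!: int_fps_intros ints theta.E_0)
qed

lemma phi_fps_nth_divisible: "\<exists>k :: int. phi_fps $ n = of_nat n * of_int k"
proof -
  have "int_fps (catalan_fps oo theta.w)"
    by (intro int_fps_compose int_catalan_fps int_w)
  then obtain k where "(catalan_fps oo theta.w) $ n = of_int k"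
    by (auto simp: int_fps_def elim: Ints_cases)
  then show ?thesis
    by (auto simp: phi_fps_def simp flip: theta.qD_catalan_compose)
qed

lemma fps_compose_X2_nth_odd: "odd n \<Longrightarrow> (F oo fps_X ^ 2) $ n = (0 :: 'a::comm_ring_1)"
  by (auto simp: fps_compose_nth fps_X_power_nth simp flip: power_mult intro!: sum.neutral)

lemma phi_fps_eq:
  fixes a c :: "complex fps"
  defines "a \<equiv> (theta_fps oo fps_X ^ 2) ^ 2" and "c \<equiv> 4 * fps_X * (theta_odd_fps oo fps_X ^ 2) ^ 2"
  shows "phi_fps = fps_const (1 / 4) * (a * c * (a ^ 2 - c ^ 2) * (a ^ 4 - 6 * a ^ 2 * c ^ 2 + c ^ 4)) *
    inverse (a ^ 2 + c ^ 2) ^ 2"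
  unfolding phi_fps_def a_def c_def by (rule theta.E_times_qD_w)

text \<open>One factor X comes from \<open>c\<close>; everything else involves only \<open>a\<close>
  and \<open>c ^ 2\<close>, which are series in X^2. \<open>K\<close> records that remaining factor
  with X^2 replaced by X.\<close>

lemma phi_fps_even_nth:
  assumes "even n"
  shows "phi_fps $ n = 0"
proof -
  define A S where "A = theta_fps ^ 2" and "S = theta_odd_fps ^ 2"
  define K where "K = A * S * (A ^ 2 - 16 * fps_X * S ^ 2) *
    (A ^ 4 - 96 * A ^ 2 * (fps_X * S ^ 2) + 256 * (fps_X * S ^ 2) ^ 2) * inverse (A ^ 2 + 16 * fps_X * S ^ 2) ^ 2"
  define a s where "a = A oo fps_X ^ 2" and "s = S oo fps_X ^ 2"
  have c: "(theta_fps oo fps_X ^ 2) ^ 2 = a" "(theta_odd_fps oo fps_X ^ 2) ^ 2 = s"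
    by (simp_all add: a_def s_def A_def S_def fps_compose_power)
  have A0: "(A ^ 2 + 16 * fps_X * S ^ 2) $ 0 = 1"
    by (simp add: A_def theta_fps_0 fps_power_zeroth)
  have "fps_const (1 / 4 :: complex) * 4 = 1"
    by (simp add: numeral_fps_const)
  then have "phi_fps = fps_X * (a * s * (a ^ 2 - 16 * fps_X ^ 2 * s ^ 2) *
      (a ^ 4 - 96 * a ^ 2 * (fps_X ^ 2 * s ^ 2) + 256 * (fps_X ^ 2 * s ^ 2) ^ 2) *
      inverse (a ^ 2 + (4 * fps_X * s) ^ 2) ^ 2)"
    unfolding phi_fps_eq c by algebra
  also have "(4 * fps_X * s) ^ 2 = 16 * fps_X ^ 2 * s ^ 2"
    by algebra
  also have "inverse (a ^ 2 + 16 * fps_X ^ 2 * s ^ 2) = inverse (A ^ 2 + 16 * fps_X * S ^ 2) oo fps_X ^ 2"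
    using A0 by (subst fps_inverse_compose)
      (simp_all add: a_def s_def fps_compose_add_distrib fps_compose_mult_distrib fps_compose_power)
  finally have eq: "phi_fps = fps_X * (K oo fps_X ^ 2)"
    by (simp add: K_def a_def s_def fps_compose_add_distrib fps_compose_sub_distrib
        fps_compose_mult_distrib fps_compose_power power_mult_distrib fps_X_power_compose)
  show ?thesis
    unfolding eq using assms by (cases n) (auto simp: fps_compose_X2_nth_odd)
qed

text \<open>Jacobi's identity theta_3^4 - theta_2^4 = theta_4^4. With \<open>x\<close> and
  \<open>y\<close> the series at Q^2, it is (x^2 + 4 Q y^2)^2 - 16 Q x^2 y^2 = (x^2 - 4 Q
  y^2)^2.\<close>

lemma theta_fourth_power_diff:
  "eventually (\<lambda>Q. theta Q ^ 4 - 16 * Q * theta_odd Q ^ 4 = theta (- Q) ^ 4) (nhds 0)"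
proof -
  have "eventually (\<lambda>Q. theta Q ^ 2 = theta (Q ^ 2) ^ 2 + 4 * Q * theta_odd (Q ^ 2) ^ 2) (nhds 0)"
    (is "eventually ?P _")
  proof -
    have "(\<lambda>Q. theta Q ^ 2 - (theta (Q ^ 2) ^ 2 + 4 * Q * theta_odd (Q ^ 2) ^ 2)) has_fps_expansion
        theta_fps ^ 2 - ((theta_fps oo fps_X ^ 2) ^ 2 + 4 * fps_X * (theta_odd_fps oo fps_X ^ 2) ^ 2)"
      by (intro fps_expansion_intros has_fps_expansion_square_arg theta_has_fps_expansion
          theta_odd_has_fps_expansion)
    also have "\<dots> = 0"
      using theta_fps_double by simp
    finally show ?thesis
      by (auto simp: has_fps_expansion_def elim!: eventually_mono)
  qed
  moreover from this have "eventually (\<lambda>Q. ?P (- Q)) (nhds 0)"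
    by (rule eventually_compose_filterlim)
      (use tendsto_minus [OF filterlim_ident [of "nhds (0 :: complex)"]] in simp)
  ultimately show ?thesis
    using eventually_norm_less_1
  proof eventually_elim
    case (elim Q)
    define x y where "x = theta (Q ^ 2)" and "y = theta_odd (Q ^ 2)"
    have "theta Q ^ 2 = x ^ 2 + 4 * Q * y ^ 2" "theta (- Q) ^ 2 = x ^ 2 - 4 * Q * y ^ 2"
      "theta_odd Q ^ 2 = x * y"
      using elim theta_odd_square [of Q] by (simp_all add: x_def y_def)
    then show ?case
      by algebra
  qed
qed

section \<open>Eta quotients and the Fourier expansion\<close>

lemma dedekind_eta_eq: "dedekind_eta z = qexp (z / 24) * euler_prod (qexp z)"
  by (simp add: dedekind_eta_def euler_prod_def)

lemma qexp_of_nat_mult: "qexp (of_nat n * z) = qexp z ^ n"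
  by (simp add: qexp_def mult_ac flip: exp_of_nat_mult)

lemma norm_qexp: "norm (qexp z) = exp (- 2 * pi * Im z)"
  by (simp add: qexp_def)

lemma eta_quotients:
  assumes "Im z > 0"
  defines "Q \<equiv> qexp z ^ 2"
  shows "(dedekind_eta (2 * z) * dedekind_eta (4 * z)) ^ 4 =
      qexp z * theta Q ^ 2 * theta_odd Q ^ 2 * theta (- Q) ^ 4" (is ?prod)
    and "psi (2 * z) = qexp z ^ 2 * theta_odd Q ^ 4 / theta Q ^ 4" (is ?psi)
    and "theta Q \<noteq> 0"
proof -
  \<comment> \<open>All eta values used are integral powers of \<open>h\<close> times Euler
    products, so no branch of a root has to be chosen.\<close>
  define h where "h = qexp (z / 24)"
  have h: "qexp (of_nat n * z / 24) = h ^ n" for n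
    using qexp_of_nat_mult [of n "z / 24"] by (simp add: h_def)
  have q: "qexp z = h ^ 24"
    using h [of 24] by simp
  have "norm (qexp z) < 1"
    using assms by (simp add: norm_qexp)
  then have Q: "norm Q < 1" "Q \<noteq> 0"
    using power_tower_less_1 [of "qexp z" 1] by (auto simp: Q_def power2_eq_square qexp_def)
  have less: "norm (Q ^ 2) < 1" "norm (Q ^ 4) < 1"
    using power_tower_less_1 [OF Q(1), of 1] power_tower_less_1 [OF Q(1), of 3] by (simp_all add: eval_nat_numeral)
  note nz = euler_prod_nonzero [OF Q(1)] less [THEN euler_prod_nonzero]
  have "qexp (2 * z) = Q" "qexp (4 * z) = Q ^ 2" "qexp (8 * z) = Q ^ 4"
    using qexp_of_nat_mult [of 2 z] qexp_of_nat_mult [of 4 z] qexp_of_nat_mult [of 8 z]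
    by (simp_all add: Q_def flip: power_mult)
  then have eta: "dedekind_eta (2 * z) = h ^ 2 * euler_prod Q" "dedekind_eta (4 * z) = h ^ 4 * euler_prod (Q ^ 2)"
    "dedekind_eta (8 * z) = h ^ 8 * euler_prod (Q ^ 4)"
    using h [of 2] h [of 4] h [of 8] by (simp_all add: dedekind_eta_eq)
  have "h \<noteq> 0"
    by (simp add: h_def qexp_def)
  note theta = theta_eq_euler_prod [OF Q(2,1)] theta_odd_eq_euler_prod [OF Q(2,1)]
    theta_minus_eq_euler_prod [OF Q(2,1)]
  show ?prod
    unfolding eta theta q using nz by (simp add: field_simps eval_nat_numeral)
  show "theta Q \<noteq> 0"
    unfolding theta using nz by simp
  have "psi (2 * z) = dedekind_eta (2 * z) ^ 8 * dedekind_eta (8 * z) ^ 16 / dedekind_eta (4 * z) ^ 24"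
    by (simp add: psi_def)
  also have "\<dots> = h ^ 48 * (euler_prod Q ^ 8 * euler_prod (Q ^ 4) ^ 16 / euler_prod (Q ^ 2) ^ 24)"
  proof -
    \<comment> \<open>The powers of \<open>h\<close> in the three eta factors: 2 * 8, 8 * 16 and 4 *
      24; what remains is h^48 = q^2.\<close>
    have "h ^ 16 * h ^ 128 = h ^ 48 * h ^ 96"
      by (simp flip: power_add)
    then show ?thesis
      unfolding eta using nz \<open>h \<noteq> 0\<close> by (simp add: power_mult_distrib field_simps flip: power_mult)
  qed
  also have "\<dots> = qexp z ^ 2 * theta_odd Q ^ 4 / theta Q ^ 4"
    unfolding theta q using nz
    by (simp add: power_mult_distrib power_divide flip: power_mult)
  finally show ?psi .
qed

text \<open>For y = psi(2 z) one has c^2 = 16 y a^2, so clearing a^4 turns the rational function of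
  y into one of \<open>a\<close> and \<open>c\<close>. The last assumption turns the theta factor at
  -(q^2) into \<open>a ^ 2 - c ^ 2\<close>.\<close>

lemma phi_eq:
  assumes "Im z > 0"
  defines "q \<equiv> qexp z"
  defines "a \<equiv> theta (q ^ 2) ^ 2" and "c \<equiv> 4 * q * theta_odd (q ^ 2) ^ 2"
  assumes "theta (q ^ 2) ^ 4 - 16 * q ^ 2 * theta_odd (q ^ 2) ^ 4 = theta (- (q ^ 2)) ^ 4"
  shows "phi z = 1 / 4 * (a * c * (a ^ 2 - c ^ 2) * (a ^ 4 - 6 * a ^ 2 * c ^ 2 + c ^ 4)) * inverse (a ^ 2 + c ^ 2) ^ 2"
proof -
  define t s where "t = theta (q ^ 2)" and "s = theta_odd (q ^ 2)"
  have "t \<noteq> 0"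
    using eta_quotients(3) [OF assms(1)] by (simp add: t_def q_def)
  define y where "y = q ^ 2 * s ^ 4 / t ^ 4"
  have y: "t ^ 4 * y = q ^ 2 * s ^ 4"
    using \<open>t \<noteq> 0\<close> by (simp add: y_def)
  have "phi z = q * t ^ 2 * s ^ 2 * (t ^ 4 - 16 * q ^ 2 * s ^ 4) * ((1 - 96 * y + 256 * y ^ 2) / (1 + 16 * y) ^ 2)"
    using eta_quotients(1,2) [OF assms(1)] assms(5)
    by (simp add: phi_def y_def t_def s_def q_def)
  also have "(1 - 96 * y + 256 * y ^ 2) / (1 + 16 * y) ^ 2 =
      ((t ^ 4) ^ 2 * (1 - 96 * y + 256 * y ^ 2)) / ((t ^ 4) ^ 2 * (1 + 16 * y) ^ 2)"
    using \<open>t \<noteq> 0\<close> by simp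
  also have "(t ^ 4) ^ 2 * (1 - 96 * y + 256 * y ^ 2) = a ^ 4 - 6 * a ^ 2 * c ^ 2 + c ^ 4"
    using y unfolding a_def c_def t_def [symmetric] s_def [symmetric] by algebra
  also have "(t ^ 4) ^ 2 * (1 + 16 * y) ^ 2 = (a ^ 2 + c ^ 2) ^ 2"
    using y unfolding a_def c_def t_def [symmetric] s_def [symmetric] by algebra
  also have "q * t ^ 2 * s ^ 2 * (t ^ 4 - 16 * q ^ 2 * s ^ 4) = 1 / 4 * (a * c * (a ^ 2 - c ^ 2))"
    unfolding a_def c_def t_def [symmetric] s_def [symmetric] by (simp add: algebra_simps flip: power_mult)
  finally show ?thesis
    by (simp add: field_simps)
qed

lemma phi_fourier_expansion: "has_fourier_expansion_at_ii_inf phi (\<lambda>n. phi_fps $ n)"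
proof -
  define f where "f q = (let a = theta (q ^ 2) ^ 2; c = 4 * q * theta_odd (q ^ 2) ^ 2 in
    1 / 4 * (a * c * (a ^ 2 - c ^ 2) * (a ^ 4 - 6 * a ^ 2 * c ^ 2 + c ^ 4)) * inverse (a ^ 2 + c ^ 2) ^ 2)" for q
  have "f has_fps_expansion phi_fps"
    unfolding f_def [abs_def] Let_def phi_fps_eq
    by (intro fps_expansion_intros has_fps_expansion_square_arg theta_has_fps_expansion
        theta_odd_has_fps_expansion) (simp add: theta_fps_0 fps_power_zeroth)
  then have R: "fps_conv_radius phi_fps > 0" and "eventually (\<lambda>q. eval_fps phi_fps q = f q) (nhds 0)"
    by (auto simp: has_fps_expansion_def)
  note this(2)
  moreover have "eventually (\<lambda>q. theta (q ^ 2) ^ 4 - 16 * q ^ 2 * theta_odd (q ^ 2) ^ 4 = theta (- (q ^ 2)) ^ 4) (nhds 0)"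
  proof (rule eventually_compose_filterlim [OF theta_fourth_power_diff])
    show "((\<lambda>q :: complex. q ^ 2) \<longlongrightarrow> 0) (nhds 0)"
      using tendsto_power [OF filterlim_ident [of "nhds (0 :: complex)"], of 2] by simp
  qed
  moreover have "eventually (\<lambda>q. q \<in> eball 0 (fps_conv_radius phi_fps)) (nhds 0)"
    using R by (intro eventually_nhds_in_open) (auto simp: zero_ereal_def)
  ultimately have "eventually (\<lambda>q. eval_fps phi_fps q = f q \<and> q \<in> eball 0 (fps_conv_radius phi_fps) \<and>
      theta (q ^ 2) ^ 4 - 16 * q ^ 2 * theta_odd (q ^ 2) ^ 4 = theta (- (q ^ 2)) ^ 4) (nhds 0)"
    by eventually_elim auto
  then obtain d where d: "d > 0" "\<And>q. norm q < d \<Longrightarrow> eval_fps phi_fps q = f q"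
    "\<And>q :: complex. norm q < d \<Longrightarrow> q \<in> eball 0 (fps_conv_radius phi_fps)"
    "\<And>q. norm q < d \<Longrightarrow> theta (q ^ 2) ^ 4 - 16 * q ^ 2 * theta_odd (q ^ 2) ^ 4 = theta (- (q ^ 2)) ^ 4"
    unfolding eventually_nhds_metric by auto
  \<comment> \<open>The second entry ensures that the norm of \<open>qexp z\<close>, which is exp(-2
    pi Im z), is below \<open>d\<close>; the first keeps \<open>Y\<close> and \<open>Im z\<close>
    positive.\<close>
  define Y where "Y = max 1 (- ln d / (2 * pi))"
  have "(\<lambda>n. phi_fps $ n * qexp z ^ n) sums phi z" if "Im z > Y" for z
  proof -
    have z: "Im z > 0" "- ln d / (2 * pi) < Im z"
      using that by (auto simp: Y_def)
    then have "- 2 * pi * Im z < ln d"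
      by (simp add: field_simps)
    then have "exp (- 2 * pi * Im z) < exp (ln d)"
      by (simp only: exp_less_cancel_iff)
    then have less: "norm (qexp z) < d"
      using d(1) by (simp add: norm_qexp)
    then have "(\<lambda>n. phi_fps $ n * qexp z ^ n) sums eval_fps phi_fps (qexp z)"
      using d(3) by (auto intro: sums_eval_fps)
    also have "eval_fps phi_fps (qexp z) = phi z"
      using d(2,4) [OF less] phi_eq [OF z(1)] by (simp add: f_def Let_def)
    finally show ?thesis .
  qed
  moreover have "Y > 0"
    by (simp add: Y_def)
  ultimately show ?thesis
    unfolding has_fourier_expansion_at_ii_inf_def by blast
qed

theorem mainTheorem1:
  "\<exists>a :: nat \<Rightarrow> int.
     has_fourier_expansion_at_ii_inf phi (\<lambda>n. of_int (a n)) \<and>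
     (\<forall>n. even n \<longrightarrow> a n = 0) \<and>
     (\<forall>n\<ge>1. int n dvd a n)"
proof -
  obtain k :: "nat \<Rightarrow> int" where k: "\<And>n. phi_fps $ n = of_nat n * of_int (k n)"
    using phi_fps_nth_divisible by metis
  then have coeff: "phi_fps $ n = of_int (int n * k n)" for n
    by simp
  have "has_fourier_expansion_at_ii_inf phi (\<lambda>n. of_int (int n * k n))"
    using phi_fourier_expansion unfolding coeff .
  moreover have "int n * k n = 0" if "even n" for n
    using phi_fps_even_nth [OF that] unfolding coeff by (simp only: of_int_eq_0_iff)
  ultimately show ?thesis
    by (intro exI [of _ "\<lambda>n. int n * k n"]) auto
qed

end
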